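(* For any $\mathbb C$-convex domain $D\subset\mathbb C^n$ one has $\kappa_D(z;X)\le4\gamma_D(z;X)$ for all $z\in D$ and $X\in\mathbb C^n$.
   Context: A domain $D\subset\mathbb C^n$ is $\mathbb C$-convex if every non-empty intersection of $D$ with a complex (affine) line is a simply connected domain (in particular connected). Let $\mathbb D\subset\mathbb C$ be the unit disc and $\mathcal O(A,B)$ the set of holomorphic maps $A\to B$. The Carathéodory (pseudo)metric is $\gamma_D(z;X)=\sup\{|f'(z)X|: f\in\mathcal O(D,\mathbb D),\ f(z)=0\}$; the Kobayashi (pseudo)metric is $\kappa_D(z;X)=\inf\{\alpha\ge0:\exists\varphi\in\mathcal O(\mathbb D,D):\varphi(0)=z,\ \alpha\varphi'(0)=X\}$. *)

theory Defs
  imports "HOL-Complex_Analysis.Complex_Analysis"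
begin

definition complex_line :: "(complex ^ 'n) set \<Rightarrow> bool"
  where "complex_line l \<longleftrightarrow> (\<exists>a b. b \<noteq> 0 \<and> l = range (\<lambda>t :: complex. a + t *s b))"

text \<open>For open \<open>D\<close> the slices \<open>D \<inter> l\<close> are open in \<open>l\<close>, so a non-empty slice is a
  simply connected domain as soon as it is simply connected; the library's
  \<^const>\<open>simply_connected\<close> includes path-connectedness.\<close>

definition C_convex :: "(complex ^ 'n) set \<Rightarrow> bool"
  where "C_convex D \<longleftrightarrow>
    (\<forall>l. complex_line l \<longrightarrow> D \<inter> l \<noteq> {} \<longrightarrow> simply_connected (D \<inter> l))"

definition holomorphic_to_disc :: "(complex ^ 'n) set \<Rightarrow> (complex ^ 'n \<Rightarrow> complex) \<Rightarrow> bool"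
  where "holomorphic_to_disc D f \<longleftrightarrow>
    (\<forall>z\<in>D. \<exists>L. Vector_Spaces.linear (*s) (*) L \<and> (f has_derivative L) (at z)) \<and>
    f ` D \<subseteq> ball 0 1"

definition holomorphic_disc_in :: "(complex ^ 'n) set \<Rightarrow> (complex \<Rightarrow> complex ^ 'n) \<Rightarrow> bool"
  where "holomorphic_disc_in D \<phi> \<longleftrightarrow>
    (\<forall>i. (\<lambda>\<zeta>. \<phi> \<zeta> $ i) holomorphic_on ball 0 1) \<and> \<phi> ` ball 0 1 \<subseteq> D"

definition caratheodory_metric :: "(complex ^ 'n) set \<Rightarrow> complex ^ 'n \<Rightarrow> complex ^ 'n \<Rightarrow> real"
  where "caratheodory_metric D z X =
    Sup {cmod (frechet_derivative f (at z) X) |f. holomorphic_to_disc D f \<and> f z = 0}"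

definition kobayashi_metric :: "(complex ^ 'n) set \<Rightarrow> complex ^ 'n \<Rightarrow> complex ^ 'n \<Rightarrow> real"
  where "kobayashi_metric D z X =
    Inf {\<alpha>. 0 \<le> \<alpha> \<and> (\<exists>\<phi>. holomorphic_disc_in D \<phi> \<and> \<phi> 0 = z \<and>
      complex_of_real \<alpha> *s (\<chi> i. deriv (\<lambda>\<zeta>. \<phi> \<zeta> $ i) 0) = X)}"

text \<open>Over the reals, \<^const>\<open>Sup\<close> and \<^const>\<open>Inf\<close> are meaningful only for non-empty sets that
  are bounded on the relevant side. The lemmas below show that this is the case at every point
  of an open set (the set defining the Kobayashi metric is clearly bounded below by 0).\<close>

lemma norm_smult_vec: "norm (c *s (x :: complex ^ 'n)) = cmod c * norm x"
  by (simp add: norm_vec_def L2_set_def norm_mult power_mult_distrib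
      flip: sum_distrib_left real_sqrt_mult)
    (simp add: real_sqrt_mult)

lemma bounded_linear_smult_vec: "bounded_linear (\<lambda>c. c *s (X :: complex ^ 'n))"
proof (rule bounded_linear_intro[of _ "norm X"])
  show "(x + y) *s X = x *s X + y *s X" for x y by (simp add: vec.scale_left_distrib)
  show "(r *\<^sub>R x) *s X = r *\<^sub>R (x *s X)" for r x by (simp add: vec_eq_iff)
  show "norm (x *s X) \<le> norm x * norm X" for x by (simp add: norm_smult_vec)
qed

lemma open_contains_line_disc:
  fixes D :: "(complex ^ 'n) set"
  assumes "open D" "z \<in> D"
  obtains r where "r > 0" "\<And>\<zeta>. cmod \<zeta> < 1 \<Longrightarrow> z + (complex_of_real r * \<zeta>) *s X \<in> D"
proof -
  obtain e where e: "e > 0" "ball z e \<subseteq> D" using assms by (meson openE)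
  define r where "r = e / (norm X + 1)"
  have r: "r > 0" using e(1) by (simp add: r_def add_nonneg_pos)
  have "z + (complex_of_real r * \<zeta>) *s X \<in> D" if "cmod \<zeta> < 1" for \<zeta>
  proof -
    have "norm ((complex_of_real r * \<zeta>) *s X) = cmod \<zeta> * (r * norm X)"
      using r by (simp add: norm_smult_vec norm_mult)
    also have "\<dots> \<le> 1 * (r * norm X)"
      using that r by (intro mult_right_mono) auto
    also have "\<dots> < r * (norm X + 1)" using r by simp
    also have "\<dots> = e" by (simp add: r_def add_nonneg_pos less_imp_neq[symmetric] add_nonneg_eq_0_iff)
    finally show ?thesis using e(2) by (auto simp: dist_norm)
  qed
  with r that show ?thesis by blast
qed

lemma caratheodory_set_nonempty:
  "{cmod (frechet_derivative f (at z) X) |f. holomorphic_to_disc D f \<and> f z = 0} \<noteq> {}"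
proof -
  have "Vector_Spaces.linear (*s) (*) (\<lambda>x :: complex ^ 'n. 0 :: complex)"
    by unfold_locales (auto simp: algebra_simps)
  then have "holomorphic_to_disc D (\<lambda>x. 0)"
    unfolding holomorphic_to_disc_def by (auto intro!: exI[of _ "\<lambda>x. 0"])
  then show ?thesis by auto
qed

lemma caratheodory_set_bdd_above:
  fixes D :: "(complex ^ 'n) set"
  assumes "open D" "z \<in> D"
  shows "bdd_above {cmod (frechet_derivative f (at z) X) |f. holomorphic_to_disc D f \<and> f z = 0}"
proof -
  obtain r where r: "r > 0" "\<And>\<zeta>. cmod \<zeta> < 1 \<Longrightarrow> z + (complex_of_real r * \<zeta>) *s X \<in> D"
    using open_contains_line_disc[OF assms] by metis
  have "cmod (frechet_derivative f (at z) X) \<le> 1 / r"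
    if f: "holomorphic_to_disc D f" "f z = 0" for f
  proof -
    define g where "g = (\<lambda>\<zeta>. z + (complex_of_real r * \<zeta>) *s X)"
    have g: "(g has_derivative (\<lambda>\<zeta>. (complex_of_real r * \<zeta>) *s X)) (at \<zeta>)" for \<zeta>
      unfolding g_def
      by (auto intro!: derivative_eq_intros bounded_linear.has_derivative[OF bounded_linear_smult_vec])
    have der: "((f \<circ> g) has_field_derivative complex_of_real r * L X) (at \<zeta>)"
      if "Vector_Spaces.linear (*s) (*) L" "(f has_derivative L) (at (g \<zeta>))" for \<zeta> L
    proof -
      interpret L: Vector_Spaces.linear "(*s)" "(*)" L by fact
      have "((f \<circ> g) has_derivative (L \<circ> (\<lambda>\<zeta>. (complex_of_real r * \<zeta>) *s X))) (at \<zeta>)"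
        using diff_chain_at[OF g that(2)] .
      moreover have "L \<circ> (\<lambda>\<zeta>. (complex_of_real r * \<zeta>) *s X) = (*) (complex_of_real r * L X)"
        by (auto simp: L.scale mult_ac)
      ultimately show ?thesis by (simp add: has_field_derivative_def)
    qed
    have gD: "g \<zeta> \<in> D" if "cmod \<zeta> < 1" for \<zeta> using r that by (simp add: g_def)
    have hol: "(f \<circ> g) holomorphic_on ball 0 1"
      unfolding holomorphic_on_open[OF open_ball]
      using der f(1) gD unfolding holomorphic_to_disc_def
      by (metis mem_ball_0)
    have bd: "cmod ((f \<circ> g) \<zeta>) < 1" if "cmod \<zeta> < 1" for \<zeta>
      using f(1) gD[OF that] unfolding holomorphic_to_disc_def by auto
    have g0: "g 0 = z" by (simp add: g_def)
    have le: "cmod (deriv (f \<circ> g) 0) \<le> 1"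
      by (rule Schwarz_Lemma(2)[OF hol _ bd, of 0]) (use f(2) g0 in auto)
    obtain L where L: "Vector_Spaces.linear (*s) (*) L" "(f has_derivative L) (at z)"
      using f(1) assms(2) unfolding holomorphic_to_disc_def by blast
    have "deriv (f \<circ> g) 0 = complex_of_real r * L X"
      using der[OF L(1), of 0] L(2) g0 by (simp add: DERIV_imp_deriv)
    moreover have "frechet_derivative f (at z) = L"
      using frechet_derivative_at[OF L(2)] by simp
    ultimately show ?thesis using le r(1) by (simp add: norm_mult field_simps)
  qed
  then show ?thesis by (auto intro!: bdd_aboveI)
qed

lemma kobayashi_set_nonempty:
  fixes D :: "(complex ^ 'n) set"
  assumes "open D" "z \<in> D"
  shows "{\<alpha>. 0 \<le> \<alpha> \<and> (\<exists>\<phi>. holomorphic_disc_in D \<phi> \<and> \<phi> 0 = z \<and>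
      complex_of_real \<alpha> *s (\<chi> i. deriv (\<lambda>\<zeta>. \<phi> \<zeta> $ i) 0) = X)} \<noteq> {}"
proof -
  obtain r where r: "r > 0" "\<And>\<zeta>. cmod \<zeta> < 1 \<Longrightarrow> z + (complex_of_real r * \<zeta>) *s X \<in> D"
    using open_contains_line_disc[OF assms] by metis
  define \<phi> where "\<phi> = (\<lambda>\<zeta>. z + (complex_of_real r * \<zeta>) *s X)"
  have "holomorphic_disc_in D \<phi>"
    using r(2) by (auto simp: holomorphic_disc_in_def \<phi>_def intro!: holomorphic_intros)
  moreover have "deriv (\<lambda>\<zeta>. \<phi> \<zeta> $ i) 0 = complex_of_real r * X $ i" for i
    by (rule DERIV_imp_deriv) (auto simp: \<phi>_def intro!: derivative_eq_intros)
  then have "complex_of_real (1 / r) *s (\<chi> i. deriv (\<lambda>\<zeta>. \<phi> \<zeta> $ i) 0) = X"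
    using r(1) by (simp add: vec_eq_iff)
  moreover have "\<phi> 0 = z" by (simp add: \<phi>_def)
  ultimately have "1 / r \<in> {\<alpha>. 0 \<le> \<alpha> \<and> (\<exists>\<phi>. holomorphic_disc_in D \<phi> \<and> \<phi> 0 = z \<and>
      complex_of_real \<alpha> *s (\<chi> i. deriv (\<lambda>\<zeta>. \<phi> \<zeta> $ i) 0) = X)}"
    using r(1) by (intro CollectI conjI exI[of _ \<phi>]) auto
  then show ?thesis by blast
qed

end

theory Submission
  imports Defs
begin

text \<open>Let \<open>d\<close> be the distance from \<open>z\<close> to the complement of \<open>D\<close> in the direction \<open>X\<close>. The affine
  disc of radius \<open>d\<close> gives \<open>\<kappa> \<le> 1 / d\<close>, so it suffices to show \<open>\<gamma> \<ge> 1 / (4 d)\<close>. Let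
  \<open>p = z + \<zeta> X \<notin> D\<close> with \<open>\<bar>\<zeta>\<bar> = d\<close>. A \<open>\<complex>\<close>-convex set stays \<open>\<complex>\<close>-convex when a complex direction is
  added to it, and in dimension at least two some complex line through \<open>p\<close> misses the set
  (otherwise the Hopf fibration would have a section). Adding such directions as long as
  possible yields a complex hyperplane through \<open>p\<close> that misses \<open>D\<close>, and projecting along it maps
  \<open>D\<close> onto a simply connected plane domain that omits \<open>\<zeta>\<close>. The Riemann map of this domain
  and Koebe's quarter theorem give the bound.

  Both topological facts come from one principle: the increment of a continuous logarithm along
  a simply connected slice depends continuously on the slice.\<close>

section \<open>Increments of logarithms along simply connected slices\<close>

text \<open>The difference of two logarithms of one function takes values in the discrete set 2 pi i
  Z, so it is constant on a connected set.\<close>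

lemma continuous_logs_differ_by_constant:
  fixes f g :: "'a::topological_space \<Rightarrow> complex"
  assumes "connected S" "continuous_on S f" "continuous_on S g"
    and eq: "\<And>x. x \<in> S \<Longrightarrow> exp (f x) = exp (g x)"
    and "a \<in> S" "b \<in> S"
  shows "f b - f a = g b - g a"
proof -
  have "(\<lambda>x. f x - g x) constant_on S"
  proof (rule continuous_discrete_range_constant[OF \<open>connected S\<close>])
    show "continuous_on S (\<lambda>x. f x - g x)"
      using assms by (intro continuous_intros)
    fix x assume x: "x \<in> S"
    show "\<exists>e>0. \<forall>y. y \<in> S \<and> f y - g y \<noteq> f x - g x \<longrightarrow> e \<le> norm (f y - g y - (f x - g x))"
    proof (intro exI[of _ "2*pi"] conjI allI impI)
      fix y assume y: "y \<in> S \<and> f y - g y \<noteq> f x - g x"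
      have "exp (f y - g y) = exp (f x - g x)"
        using eq[OF x] eq[of y] y by (simp add: exp_diff)
      then obtain n :: int where n: "f y - g y = (f x - g x) + (of_int (2 * n) * pi) * \<i>"
        unfolding exp_eq by blast
      with y have "n \<noteq> 0" by auto
      then have "1 \<le> \<bar>real_of_int n\<bar>" by linarith
      then have "2 * pi * 1 \<le> 2 * pi * \<bar>real_of_int n\<bar>" by (intro mult_left_mono) auto
      moreover have "norm (f y - g y - (f x - g x)) = 2 * pi * \<bar>real_of_int n\<bar>"
        unfolding n by (simp add: norm_mult)
      ultimately show "2 * pi \<le> norm (f y - g y - (f x - g x))" by simp
    qed simp
  qed
  then obtain c where "\<And>x. x \<in> S \<Longrightarrow> f x - g x = c" unfolding constant_on_def by blast
  from this[OF \<open>a \<in> S\<close>] this[OF \<open>b \<in> S\<close>] show ?thesis by (simp add: algebra_simps)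
qed

text \<open>The winding number is the increment of a logarithm of \<open>z - \<zeta>\<close> along
  the path, divided by 2 pi i. A logarithm living on the image takes equal values at the coinciding
  endpoints. The factor \<open>c\<close> allows for a normalisation at a base point.\<close>

lemma winding_number_zero_continuous_log:
  assumes p: "path p" "pathfinish p = pathstart p" and \<zeta>: "\<zeta> \<notin> path_image p"
    and L: "continuous_on (path_image p) L"
    and exp_L: "\<And>z. z \<in> path_image p \<Longrightarrow> exp (L z) = c * (z - \<zeta>)" and "c \<noteq> 0"
  shows "winding_number p \<zeta> = 0"
proof -
  obtain q where q: "path q" "pathfinish q - pathstart q = 2 * of_real pi * \<i> * winding_number p \<zeta>"
      "\<And>t. t \<in> {0..1} \<Longrightarrow> p t = \<zeta> + exp (q t)"
    using winding_number_as_continuous_log[OF p(1) \<zeta>] by blast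
  have "(Ln c + q 1) - (Ln c + q 0) = L (p 1) - L (p 0)"
  proof (rule continuous_logs_differ_by_constant[of "{0..1::real}" "\<lambda>t. Ln c + q t" "\<lambda>t. L (p t)"])
    show "continuous_on {0..1} (\<lambda>t. Ln c + q t)"
      using q(1) unfolding path_def by (intro continuous_intros)
    show "continuous_on {0..1} (\<lambda>t. L (p t))"
      using continuous_on_compose2[OF L] p(1) unfolding path_def path_image_def by blast
    show "exp (Ln c + q t) = exp (L (p t))" if "t \<in> {0..1}" for t
    proof -
      have "p t \<in> path_image p" using that by (auto simp: path_image_def)
      from exp_L[OF this] q(3)[OF that] \<open>c \<noteq> 0\<close> show ?thesis by (simp add: exp_add)
    qed
  qed auto
  with q(2) p(2) show ?thesis by (simp add: pathfinish_def pathstart_def)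
qed

text \<open>The chosen logarithm depends on \<open>F\<close> and \<open>S\<close> but not on the
  endpoints, so all increments on one slice come from a single \<open>g\<close> and are
  additive.\<close>

definition log_incr :: "(complex \<Rightarrow> complex) \<Rightarrow> complex set \<Rightarrow> complex \<Rightarrow> complex \<Rightarrow> complex"
  where "log_incr F S a b =
    (let g = SOME g. continuous_on S g \<and> (\<forall>z\<in>S. exp (g z) = F z) in g b - g a)"

lemma log_incr_ex:
  assumes "open S" "simply_connected S" "continuous_on S F" "\<forall>z\<in>S. F z \<noteq> 0"
  shows "\<exists>g. continuous_on S g \<and> (\<forall>z\<in>S. exp (g z) = F z) \<and> (\<forall>a b. log_incr F S a b = g b - g a)"
proof -
  define g where "g = (SOME g. continuous_on S g \<and> (\<forall>z\<in>S. exp (g z) = F z))"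
  have "\<exists>g. continuous_on S g \<and> (\<forall>z\<in>S. exp (g z) = F z)"
    using assms unfolding simply_connected_eq_continuous_log[OF \<open>open S\<close>] by metis
  then have "continuous_on S g \<and> (\<forall>z\<in>S. exp (g z) = F z)"
    unfolding g_def by (rule someI_ex)
  then show ?thesis by (intro exI[of _ g]) (auto simp: log_incr_def g_def Let_def)
qed

text \<open>Any logarithm on a connected part of the slice that contains both endpoints computes the
  increment. This localisation is what lets slices vary.\<close>

lemma log_incr_eq:
  assumes S: "open S" "simply_connected S" "continuous_on S F" "\<forall>z\<in>S. F z \<noteq> 0"
    and C: "connected C" "C \<subseteq> S" "a \<in> C" "b \<in> C"
    and g: "continuous_on C g" "\<And>z. z \<in> C \<Longrightarrow> exp (g z) = F z"
  shows "log_incr F S a b = g b - g a"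
proof -
  obtain g' where g': "continuous_on S g'" "\<And>z. z \<in> S \<Longrightarrow> exp (g' z) = F z"
    "\<And>a b. log_incr F S a b = g' b - g' a" using log_incr_ex[OF S] by blast
  have "g' b - g' a = g b - g a"
    using C g g' by (intro continuous_logs_differ_by_constant[of C])
      (auto intro: continuous_on_subset)
  with g' show ?thesis by simp
qed

text \<open>Slices may change abruptly with \<open>m\<close>, but the increment is determined on a
  compact connected set \<open>C\<close> around both endpoints. By the tube lemma \<open>C\<close>
  stays inside nearby slices, where \<open>g0\<close> corrected by the principal logarithm of
  \<open>F m / F m0\<close> is a logarithm of \<open>F m\<close> and jointly continuous.\<close>

lemma isCont_log_incr:
  fixes X :: "('m::t2_space \<times> complex) set" and F :: "'m \<Rightarrow> complex \<Rightarrow> complex"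
  assumes X: "open X" and sc: "\<And>m. simply_connected {s. (m, s) \<in> X}"
    and F: "continuous_on X (\<lambda>(m, s). F m s)" and F0: "\<And>m s. (m, s) \<in> X \<Longrightarrow> F m s \<noteq> 0"
    and ab: "(m0, a0) \<in> X" "(m0, b0) \<in> X"
  shows "isCont (\<lambda>(m, a, b). log_incr (F m) {s. (m, s) \<in> X} a b) (m0, a0, b0)"
proof -
  let ?S = "\<lambda>m. {s. (m, s) \<in> X}"
  have opS: "open (?S m)" for m
    using open_vimage[OF X, of "Pair m"] by (simp add: vimage_def continuous_on_Pair)
  have F0': "\<forall>s\<in>?S m. F m s \<noteq> 0" for m using F0 by simp
  have contF: "continuous_on (?S m) (F m)" for m
    using continuous_on_compose2[OF F, of "?S m" "\<lambda>s. (m, s)"] by (force intro: continuous_intros)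
  obtain g0 where g0: "continuous_on (?S m0) g0" "\<And>z. z \<in> ?S m0 \<Longrightarrow> exp (g0 z) = F m0 z"
    using log_incr_ex[OF opS sc contF F0'] by blast
  obtain r1 where r1: "r1 > 0" "cball a0 r1 \<subseteq> ?S m0"
    using opS ab(1) by (metis mem_Collect_eq open_contains_cball)
  obtain r2 where r2: "r2 > 0" "cball b0 r2 \<subseteq> ?S m0"
    using opS ab(2) by (metis mem_Collect_eq open_contains_cball)
  obtain \<gamma> where \<gamma>: "path \<gamma>" "path_image \<gamma> \<subseteq> ?S m0" "pathstart \<gamma> = a0" "pathfinish \<gamma> = b0"
    using simply_connected_imp_path_connected[OF sc[of m0]] ab unfolding path_connected_def by blast
  \<comment> \<open>The path makes \<open>C\<close> connected; the discs leave room for both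
    endpoints to move.\<close>
  define C where "C = cball a0 r1 \<union> path_image \<gamma> \<union> cball b0 r2"
  have a0\<gamma>: "a0 \<in> path_image \<gamma>" and b0\<gamma>: "b0 \<in> path_image \<gamma>"
    using \<gamma> pathstart_in_path_image pathfinish_in_path_image by blast+
  have C: "compact C" "connected C" "C \<subseteq> ?S m0"
  proof -
    show "compact C" unfolding C_def using \<gamma> by (intro compact_Un compact_path_image) auto
    have "cball a0 r1 \<inter> path_image \<gamma> \<noteq> {}"
      using a0\<gamma> r1(1) by (intro ex_in_conv[THEN iffD1] exI[of _ a0]) auto
    then have "connected (cball a0 r1 \<union> path_image \<gamma>)"
      by (rule connected_Un[OF connected_cball connected_path_image[OF \<gamma>(1)]])
    moreover have "(cball a0 r1 \<union> path_image \<gamma>) \<inter> cball b0 r2 \<noteq> {}"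
      using b0\<gamma> r2(1) by (intro ex_in_conv[THEN iffD1] exI[of _ b0]) auto
    ultimately show "connected C"
      unfolding C_def using connected_Un connected_cball by blast
    show "C \<subseteq> ?S m0" using r1 r2 \<gamma> by (auto simp: C_def)
  qed
  define Y where "Y = X \<inter> UNIV \<times> ?S m0"
  \<comment> \<open>The inequality places \<open>F m / F m0\<close> within distance 1 of 1, away
    from the branch cut of \<open>Ln\<close>.\<close>
  define X' where "X' = {x\<in>Y. cmod (F (fst x) (snd x) - F m0 (snd x)) < cmod (F m0 (snd x))}"
  have opY: "open Y" unfolding Y_def using X opS by (intro open_Int open_Times) auto
  have contY1: "continuous_on Y (\<lambda>x. F (fst x) (snd x))"
    using continuous_on_subset[OF F, of Y] by (auto simp: Y_def split_beta)
  have contY2: "continuous_on Y (\<lambda>x. F m0 (snd x))"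
    using continuous_on_compose2[OF contF[of m0], of Y snd] by (force simp: Y_def intro: continuous_intros)
  have opX': "open X'"
  proof -
    have "open (Y \<inter> (\<lambda>x. cmod (F m0 (snd x)) - cmod (F (fst x) (snd x) - F m0 (snd x))) -` {0<..})"
      using opY contY1 contY2 by (intro continuous_open_preimage continuous_intros) auto
    also have "\<dots> = X'" by (auto simp: X'_def)
    finally show ?thesis .
  qed
  have "{m0} \<times> C \<subseteq> X'" using C(3) F0 by (auto simp: X'_def Y_def)
  from Elementary_Topology.tube_lemma[OF C(1) opX' this]
  obtain U where U: "m0 \<in> U" "open U" "U \<times> C \<subseteq> X'" by blast
  have quot: "F m z / F m0 z \<notin> \<real>\<^sub>\<le>\<^sub>0" "F m0 z \<noteq> 0" "F m z \<noteq> 0" if "(m, z) \<in> X'" for m z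
  proof -
    have *: "cmod (F m z - F m0 z) < cmod (F m0 z)" using that by (auto simp: X'_def)
    then show 0: "F m0 z \<noteq> 0" by auto
    show "F m z \<noteq> 0" using that F0 by (auto simp: X'_def Y_def)
    have "F m z / F m0 z - 1 = (F m z - F m0 z) / F m0 z"
      using 0 by (simp add: diff_divide_distrib)
    then have "cmod (F m z / F m0 z - 1) < 1"
      using * 0 by (simp add: norm_divide)
    then have "\<bar>Re (F m z / F m0 z - 1)\<bar> < 1" using abs_Re_le_cmod le_less_trans by blast
    then show "F m z / F m0 z \<notin> \<real>\<^sub>\<le>\<^sub>0" by (auto simp: complex_nonpos_Reals_iff)
  qed
  let ?Q = "\<lambda>m z. g0 z + Ln (F m z / F m0 z)"
  have incr: "log_incr (F m) (?S m) a b = ?Q m b - ?Q m a" if m: "m \<in> U" "a \<in> C" "b \<in> C" for m a b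
  proof (rule log_incr_eq[OF opS sc contF F0' C(2) _ m(2,3)])
    have UC: "(m, z) \<in> X'" if "z \<in> C" for z using U m that by auto
    show "C \<subseteq> ?S m" using UC by (auto simp: X'_def Y_def)
    then show "continuous_on C (\<lambda>z. ?Q m z)"
      using C(3) quot[OF UC] by (intro continuous_intros continuous_on_subset[OF g0(1)]
          continuous_on_subset[OF contF]) blast+
    show "exp (?Q m z) = F m z" if "z \<in> C" for z
      using g0(2)[of z] C(3) that quot[OF UC[OF that]] by (auto simp: exp_add)
  qed
  let ?R = "\<lambda>x::'m \<times> complex. ?Q (fst x) (snd x)"
  have contR: "continuous_on X' ?R"
  proof -
    have "continuous_on X' (\<lambda>x. g0 (snd x))"
      by (rule continuous_on_compose2[OF g0(1)]) (auto simp: X'_def Y_def intro: continuous_intros)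
    moreover have "X' \<subseteq> Y" by (auto simp: X'_def)
    ultimately show ?thesis using quot
      by (intro continuous_intros continuous_on_subset[OF contY1] continuous_on_subset[OF contY2]) auto
  qed
  have inC: "a0 \<in> C" "b0 \<in> C" using a0\<gamma> b0\<gamma> by (auto simp: C_def)
  have contab: "isCont ?R (m0, c)" if "c \<in> C" for c
    using contR U that opX' by (auto simp: continuous_on_eq_continuous_at)
  have cont: "isCont (\<lambda>x. ?R (fst x, snd (snd x)) - ?R (fst x, fst (snd x))) (m0, a0, b0)"
  proof (rule continuous_diff)
    show "isCont (\<lambda>x. ?R (fst x, snd (snd x))) (m0, a0, b0)"
      by (rule isCont_o2[where f="\<lambda>x. (fst x, snd (snd x))" and g="?R"])
        (use contab[OF inC(2)] in \<open>auto intro!: continuous_intros\<close>)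
    show "isCont (\<lambda>x. ?R (fst x, fst (snd x))) (m0, a0, b0)"
      by (rule isCont_o2[where f="\<lambda>x. (fst x, fst (snd x))" and g="?R"])
        (use contab[OF inC(1)] in \<open>auto intro!: continuous_intros\<close>)
  qed
  have "eventually (\<lambda>x. x \<in> U \<times> (ball a0 r1 \<times> ball b0 r2)) (nhds (m0, a0, b0))"
    using U r1 r2 by (intro eventually_nhds_in_open open_Times) auto
  then have "eventually (\<lambda>x. ?R (fst x, snd (snd x)) - ?R (fst x, fst (snd x)) =
      (case x of (m, a, b) \<Rightarrow> log_incr (F m) (?S m) a b)) (nhds (m0, a0, b0))"
  proof (rule eventually_mono, clarify)
    fix m a b assume "m \<in> U" "a \<in> ball a0 r1" "b \<in> ball b0 r2"
    moreover from this have "a \<in> C" "b \<in> C" by (auto simp: C_def)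
    ultimately show "?R (fst (m, a, b), snd (snd (m, a, b))) - ?R (fst (m, a, b), fst (snd (m, a, b))) =
      log_incr (F m) (?S m) a b" using incr[of m a b] by simp
  qed
  from isCont_cong[OF this] cont show ?thesis by blast
qed

text \<open>Two points of \<open>E\<close> lie on a common complex line, whose slice is
  connected.\<close>

lemma connected_lines_connected:
  fixes E :: "(complex \<times> complex) set"
  assumes lines: "\<And>s0 t0 s1 t1. simply_connected {\<mu>. (s0 + \<mu> * s1, t0 + \<mu> * t1) \<in> E}"
  shows "connected E"
  unfolding connected_iff_connected_component
proof (intro ballI)
  fix e e' assume e: "e \<in> E" "e' \<in> E"
  let ?h = "\<lambda>\<mu>. (fst e + \<mu> * (fst e' - fst e), snd e + \<mu> * (snd e' - snd e))"
  let ?S = "{\<mu>. ?h \<mu> \<in> E}"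
  have "connected (?h ` ?S)"
    by (intro connected_continuous_image continuous_intros simply_connected_imp_connected lines)
  moreover have "e \<in> ?h ` ?S" by (rule image_eqI[where x=0]) (use e in auto)
  moreover have "e' \<in> ?h ` ?S" by (rule image_eqI[where x=1]) (use e in auto)
  moreover have "?h ` ?S \<subseteq> E" by auto
  ultimately show "connected_component E e e'" unfolding connected_component_def by blast
qed

section \<open>Projections of sets with simply connected slices\<close>

text \<open>If \<open>\<zeta>\<close> is omitted by the projection, integrating along the lines through a base point yields
  a logarithm of \<open>t - \<zeta>\<close> on \<open>E\<close>. It is constant on the connected fibres and so descends to
  the projection, on which all winding numbers around \<open>\<zeta>\<close> therefore vanish.\<close>

lemma simply_connected_projection:
  fixes E :: "(complex \<times> complex) set"
  assumes E: "open E"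
    and lines: "\<And>s0 t0 s1 t1. simply_connected {\<mu>. (s0 + \<mu> * s1, t0 + \<mu> * t1) \<in> E}"
  shows "simply_connected (snd ` E)"
proof -
  let ?\<Omega> = "snd ` E"
  have op: "open ?\<Omega>" using E by (rule open_image_snd)
  have con: "connected ?\<Omega>"
    using connected_lines_connected[OF lines] by (intro connected_continuous_image continuous_intros)
  have log: "\<exists>L c. continuous_on ?\<Omega> L \<and> c \<noteq> 0 \<and> (\<forall>t\<in>?\<Omega>. exp (L t) = c * (t - \<zeta>))"
    if \<zeta>: "\<zeta> \<notin> ?\<Omega>" and ne: "E \<noteq> {}" for \<zeta>
  proof -
    obtain s0 t0 where e0: "(s0, t0) \<in> E" using ne by auto
    \<comment> \<open>The family is indexed by the endpoint \<open>e\<close>: along the line,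
      \<open>\<mu> = 0\<close> is the base point and \<open>\<mu> = 1\<close> is
      \<open>e\<close>.\<close>
    define X where "X = {(e, \<mu>). (s0 + \<mu> * (fst e - s0), t0 + \<mu> * (snd e - t0)) \<in> E}"
    define F where "F = (\<lambda>(e :: complex \<times> complex) \<mu>. t0 + \<mu> * (snd e - t0) - \<zeta>)"
    define L where "L = (\<lambda>e. log_incr (F e) {\<mu>. (e, \<mu>) \<in> X} 0 1)"
    have opX: "open X"
    proof -
      have "open ((\<lambda>x. (s0 + snd x * (fst (fst x) - s0), t0 + snd x * (snd (fst x) - t0))) -` E)"
        by (intro open_vimage E continuous_intros)
      also have "\<dots> = X" by (auto simp: X_def)
      finally show ?thesis .
    qed
    have sc: "simply_connected {\<mu>. (e, \<mu>) \<in> X}" for e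
      unfolding X_def using lines by simp
    have contF: "continuous_on X (\<lambda>(e, \<mu>). F e \<mu>)"
      by (auto simp: F_def split_beta intro!: continuous_intros)
    have F0: "F e \<mu> \<noteq> 0" if "(e, \<mu>) \<in> X" for e \<mu>
      using that \<zeta> by (force simp: X_def F_def)
    have inX: "(e, 0) \<in> X" "(e, 1) \<in> X" if "e \<in> E" for e
      using that e0 by (auto simp: X_def)
    have contL: "continuous_on E L"
    proof (intro continuous_at_imp_continuous_on ballI)
      fix e assume "e \<in> E"
      from isCont_log_incr[OF opX sc contF F0 inX[OF this]]
      have "isCont (\<lambda>(m, a, b). log_incr (F m) {s. (m, s) \<in> X} a b) (e, 0, 1)" by blast
      then have "isCont (\<lambda>e. (\<lambda>(m, a, b). log_incr (F m) {s. (m, s) \<in> X} a b) (e, 0, 1)) e"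
        by (rule isCont_o2[where f="\<lambda>e. (e, 0, 1)", rotated]) (intro continuous_intros)
      then show "isCont L e" by (simp add: L_def)
    qed
    have expL: "exp (L e) = (snd e - \<zeta>) / (t0 - \<zeta>)" if e: "e \<in> E" for e
    proof -
      have "open {\<mu>. (e, \<mu>) \<in> X}"
        using open_vimage[OF opX, of "Pair e"] by (simp add: vimage_def continuous_on_Pair)
      moreover have "continuous_on {\<mu>. (e, \<mu>) \<in> X} (F e)"
        by (auto simp: F_def intro!: continuous_intros)
      ultimately obtain g where "\<And>z. z \<in> {\<mu>. (e, \<mu>) \<in> X} \<Longrightarrow> exp (g z) = F e z"
        "\<And>a b. log_incr (F e) {\<mu>. (e, \<mu>) \<in> X} a b = g b - g a"
        using log_incr_ex[OF _ sc[of e], of "F e"] F0 by fastforce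
      with inX[OF e] show ?thesis by (simp add: L_def exp_diff F_def)
    qed
    have L_fibre: "L (s, t) = L (s', t)" if "(s, t) \<in> E" "(s', t) \<in> E" for s s' t
    proof -
      have con: "connected {\<mu>. (\<mu>, t) \<in> E}"
        using simply_connected_imp_connected[OF lines[of 0 1 t 0]] by simp
      have "L (s, t) - L (s', t) = Ln ((t - \<zeta>) / (t0 - \<zeta>)) - Ln ((t - \<zeta>) / (t0 - \<zeta>))"
      proof (rule continuous_logs_differ_by_constant[OF con, where f="\<lambda>s. L (s, t)"
            and g="\<lambda>s. Ln ((t - \<zeta>) / (t0 - \<zeta>))"])
        show "continuous_on {\<mu>. (\<mu>, t) \<in> E} (\<lambda>s. L (s, t))"
          by (rule continuous_on_compose2[OF contL]) (auto intro: continuous_intros)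
        show "exp (L (x, t)) = exp (Ln ((t - \<zeta>) / (t0 - \<zeta>)))" if "x \<in> {\<mu>. (\<mu>, t) \<in> E}" for x
          using expL[of "(x, t)"] exp_not_eq_zero[of "L (x, t)"] that by (simp del: exp_not_eq_zero)
      qed (use that in auto)
      then show ?thesis by simp
    qed
    define \<sigma> where "\<sigma> t = (SOME s. (s, t) \<in> E)" for t
    have \<sigma>: "(\<sigma> t, t) \<in> E" if "t \<in> ?\<Omega>" for t
      using that unfolding \<sigma>_def by (force intro: someI)
    \<comment> \<open>The section \<open>\<sigma>\<close> may jump. Near \<open>t\<close> it can be
      frozen at \<open>\<sigma> t\<close>, because \<open>E\<close> is open and \<open>L\<close> is
      constant on fibres.\<close>
    have "continuous_on ?\<Omega> (\<lambda>t. L (\<sigma> t, t))"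
    proof (intro continuous_at_imp_continuous_on ballI)
      fix t assume t: "t \<in> ?\<Omega>"
      have cont: "isCont (\<lambda>t'. L (\<sigma> t, t')) t"
        using contL \<sigma>[OF t] E
        by (intro isCont_o2[where g=L and f="Pair (\<sigma> t)"])
          (auto simp: continuous_on_eq_continuous_at intro!: continuous_intros)
      have "open {t'. (\<sigma> t, t') \<in> E}"
        using open_vimage[OF E, of "Pair (\<sigma> t)"] by (simp add: vimage_def continuous_on_Pair)
      then have "eventually (\<lambda>t'. t' \<in> {t'. (\<sigma> t, t') \<in> E}) (nhds t)"
        using \<sigma>[OF t] by (intro eventually_nhds_in_open) auto
      then have "eventually (\<lambda>t'. L (\<sigma> t, t') = L (\<sigma> t', t')) (nhds t)"
      proof (rule eventually_mono)
        fix t' assume "t' \<in> {t'. (\<sigma> t, t') \<in> E}"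
        then have t': "(\<sigma> t, t') \<in> E" by simp
        moreover from this have "t' \<in> ?\<Omega>" by (rule image_eqI[rotated]) simp
        ultimately show "L (\<sigma> t, t') = L (\<sigma> t', t')" using L_fibre \<sigma> by blast
      qed
      from isCont_cong[OF this] cont show "isCont (\<lambda>t. L (\<sigma> t, t)) t" by blast
    qed
    moreover have "exp (L (\<sigma> t, t)) = (1 / (t0 - \<zeta>)) * (t - \<zeta>)" if "t \<in> ?\<Omega>" for t
      using expL[OF \<sigma>[OF that]] by simp
    moreover have "t0 - \<zeta> \<noteq> 0" using \<zeta> e0 by force
    ultimately show ?thesis
      by (intro exI[of _ "\<lambda>t. L (\<sigma> t, t)"] exI[of _ "1 / (t0 - \<zeta>)"]) auto
  qed
  show ?thesis
    unfolding simply_connected_eq_winding_number_zero[OF op]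
  proof (intro conjI con allI impI, elim conjE)
    fix g \<zeta> assume g: "path g" "path_image g \<subseteq> ?\<Omega>" "pathfinish g = pathstart g" "\<zeta> \<notin> ?\<Omega>"
    have "E \<noteq> {}" using g(2) path_image_nonempty[of g] by auto
    from log[OF g(4) this] obtain L c where L: "continuous_on ?\<Omega> L" "c \<noteq> 0"
      "\<And>t. t \<in> ?\<Omega> \<Longrightarrow> exp (L t) = c * (t - \<zeta>)" by blast
    then show "winding_number g \<zeta> = 0"
      using g by (intro winding_number_zero_continuous_log[of g \<zeta> L c]) (blast intro: continuous_on_subset)+
  qed
qed

section \<open>Complex lines through a point avoiding a set in dimension two\<close>

lemma isCont_mult_locally_zero:
  fixes f g :: "'a::t2_space \<Rightarrow> complex"
  assumes "isCont f x" and "isCont g x \<or> eventually (\<lambda>y. f y = 0) (nhds x)"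
  shows "isCont (\<lambda>y. f y * g y) x"
  using assms(2)
proof
  assume "isCont g x"
  with assms(1) show ?thesis by (intro continuous_intros)
next
  assume "eventually (\<lambda>y. f y = 0) (nhds x)"
  then have "eventually (\<lambda>y. f y * g y = 0) (nhds x)" by (rule eventually_mono) simp
  from isCont_cong[OF this] show ?thesis by simp
qed

text \<open>A zero-free \<open>u\<close> has a continuous logarithm on the disc, which would force
  the boundary circle to have winding number 0 about the origin.\<close>

lemma no_log_near_infinity:
  fixes u :: "complex \<Rightarrow> complex"
  assumes u: "continuous_on UNIV u" "\<And>m. u m \<noteq> 0"
    and r: "r > 0" and eq: "\<And>m. cmod m = r \<Longrightarrow> u m = m / c" and "c \<noteq> 0"
  shows False
proof -
  obtain w where w: "continuous_on (cball 0 r) w" "\<And>m. m \<in> cball 0 r \<Longrightarrow> u m = exp (w m)"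
    using continuous_logarithm_on_cball[OF continuous_on_subset[OF u(1)], of 0 r] u(2) by auto
  have "winding_number (circlepath 0 r) 0 = 0"
  proof (rule winding_number_zero_continuous_log[where L=w and c="1/c"])
    show "continuous_on (path_image (circlepath 0 r)) w"
      using r by (intro continuous_on_subset[OF w(1)]) auto
    show "exp (w z) = 1 / c * (z - 0)" if "z \<in> path_image (circlepath 0 r)" for z
      using that r w(2)[of z] eq[of z] by simp
  qed (use r \<open>c \<noteq> 0\<close> in auto)
  moreover have "winding_number (circlepath 0 r) 0 = 1"
    using r by (simp add: winding_number_circlepath)
  ultimately show False by simp
qed

text \<open>If every line through the origin met \<open>E\<close>, then a weighted average \<open>P\<close> of logarithm
  increments would satisfy \<open>P (m, s) - P (m, s') = log s - log s'\<close> on the line of slope \<open>m\<close>, so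
  that \<open>u m = exp (P (m, s)) / s\<close> would not depend on \<open>s\<close>. Basing the average at a point of the
  vertical line for large \<open>m\<close> makes \<open>u\<close> a zero-free continuous function on the plane that is a
  multiple of \<open>m\<close> near infinity.\<close>

lemma line_through_origin_avoiding:
  fixes E :: "(complex \<times> complex) set"
  assumes E: "open E" and 0: "(0, 0) \<notin> E"
    and lines: "\<And>x y. simply_connected {\<mu>. (\<mu> * x, \<mu> * y) \<in> E}"
  shows "\<exists>x y. (x, y) \<noteq> (0, 0) \<and> (\<forall>\<mu>. (\<mu> * x, \<mu> * y) \<notin> E)"
proof (rule ccontr)
  assume "\<not> ?thesis"
  then have meet: "\<exists>\<mu>. (\<mu> * x, \<mu> * y) \<in> E" if "(x, y) \<noteq> (0, 0)" for x y
    using that by blast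
  \<comment> \<open>On the line of slope \<open>m\<close> the parameter \<open>s\<close> is the
    first coordinate, and \<open>incr\<close> measures increments of log \<open>s\<close>. The
    vertical line is the slope at infinity.\<close>
  define X where "X = {(m, s). (s, s * m) \<in> E}"
  define F where "F = (\<lambda>(m :: complex) (s :: complex). s)"
  define incr where "incr = (\<lambda>m. log_incr (F m) {s. (m, s) \<in> X})"
  have opX: "open X"
  proof -
    have "open ((\<lambda>x. (snd x, snd x * fst x)) -` E)"
      by (intro open_vimage E continuous_intros)
    also have "\<dots> = X" by (auto simp: X_def)
    finally show ?thesis .
  qed
  have opS: "open {s. (m, s) \<in> X}" for m
    using open_vimage[OF opX, of "Pair m"] by (simp add: vimage_def continuous_on_Pair)
  have sc: "simply_connected {s. (m, s) \<in> X}" for m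
    unfolding X_def using lines[of 1 m] by simp
  have contF: "continuous_on X (\<lambda>(m, s). F m s)"
    by (auto simp: F_def split_beta intro!: continuous_intros)
  have F0: "F m s \<noteq> 0" if "(m, s) \<in> X" for m s
    using that 0 by (auto simp: X_def F_def)
  have incr_log: "\<exists>g. (\<forall>s. (m, s) \<in> X \<longrightarrow> exp (g s) = s) \<and> (\<forall>a b. incr m a b = g b - g a)" for m
  proof -
    have "continuous_on {s. (m, s) \<in> X} (F m)" by (simp add: F_def)
    from log_incr_ex[OF opS sc this] F0 show ?thesis
      unfolding incr_def by (auto simp: F_def)
  qed
  have isCont_incr: "isCont (\<lambda>(m, s). incr m (\<tau> m) s) (m, s)"
    if "(m, \<tau> m) \<in> X" "(m, s) \<in> X" "isCont \<tau> m" for m s \<tau>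
  proof -
    have "isCont (\<lambda>(m, a, b). incr m a b) (m, \<tau> m, s)"
      unfolding incr_def using isCont_log_incr[OF opX sc contF F0 that(1,2)] by blast
    moreover have "isCont (\<lambda>x. (fst x, \<tau> (fst x), snd x)) (m, s)"
    proof -
      have "isCont (\<lambda>x. \<tau> (fst x)) (m, s)"
        by (rule isCont_o2[where g=\<tau> and f=fst]) (use that(3) in \<open>auto intro!: continuous_intros\<close>)
      then show ?thesis by (intro continuous_intros)
    qed
    ultimately have "isCont (\<lambda>x. (\<lambda>(m, a, b). incr m a b) (fst x, \<tau> (fst x), snd x)) (m, s)"
      using isCont_o2[of "(m, s)" "\<lambda>x. (fst x, \<tau> (fst x), snd x)" "\<lambda>(m, a, b). incr m a b"] by simp
    then show ?thesis by (simp add: case_prod_unfold)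
  qed
  define \<sigma> where "\<sigma> m = (SOME s. (m, s) \<in> X)" for m
  have \<sigma>: "(m, \<sigma> m) \<in> X" for m
  proof -
    have "\<exists>s. (m, s) \<in> X" using meet[of 1 m] by (auto simp: X_def)
    then show ?thesis unfolding \<sigma>_def by (rule someI_ex)
  qed
  obtain t0 where t0: "(0, t0) \<in> E" using meet[of 0 1] by auto
  have "t0 \<noteq> 0" using t0 0 by auto
  \<comment> \<open>The line of slope \<open>m\<close> reaches height \<open>t0\<close> at
    \<open>s = t0 / m\<close>, which tends to 0 as \<open>m\<close> grows; so that point is close to
    \<open>(0, t0)\<close>.\<close>
  obtain R where R: "R > 0" "\<And>m. cmod m > R \<Longrightarrow> (m, t0 / m) \<in> X"
  proof -
    have "open {s. (s, t0) \<in> E}"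
      using open_vimage[OF E, of "\<lambda>s. (s, t0)"] by (simp add: vimage_def continuous_on_Pair)
    then obtain \<delta> where \<delta>: "\<delta> > 0" "ball 0 \<delta> \<subseteq> {s. (s, t0) \<in> E}"
      using t0 by (metis mem_Collect_eq openE)
    show ?thesis
    proof (rule that[of "cmod t0 / \<delta>"])
      show "(m, t0 / m) \<in> X" if "cmod t0 / \<delta> < cmod m" for m
      proof -
        have m: "cmod m > 0" by (rule le_less_trans[OF _ that]) (use \<delta> in auto)
        then have "t0 / m \<in> ball 0 \<delta>" using that \<delta> by (simp add: norm_divide field_simps)
        with \<delta>(2) m show ?thesis by (auto simp: X_def)
      qed
    qed (use \<delta> \<open>t0 \<noteq> 0\<close> in auto)
  qed
  \<comment> \<open>The factor 2 leaves a margin around the support of the later weight of radius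
    \<open>r m\<close>, so that the base point \<open>\<sigma> m\<close> stays valid near it. The
    bound 1 keeps these weights away from the circle of radius \<open>R + 4\<close>.\<close>
  have "\<exists>r. 0 < r \<and> r \<le> 1 \<and> (\<forall>m'\<in>ball m (2 * r). (m', \<sigma> m) \<in> X)" for m
  proof -
    have "open {m'. (m', \<sigma> m) \<in> X}"
      using open_vimage[OF opX, of "\<lambda>m'. (m', \<sigma> m)"] by (simp add: vimage_def continuous_on_Pair)
    then obtain \<delta> where \<delta>: "\<delta> > 0" "ball m \<delta> \<subseteq> {m'. (m', \<sigma> m) \<in> X}"
      using \<sigma> by (metis mem_Collect_eq openE)
    then show ?thesis by (intro exI[of _ "min 1 (\<delta> / 2)"]) (auto simp: subset_iff)
  qed
  then obtain r where r: "\<And>m. 0 < r m" "\<And>m. r m \<le> 1"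
    "\<And>m m'. m' \<in> ball m (2 * r m) \<Longrightarrow> (m', \<sigma> m) \<in> X"
    by metis
  obtain I where I: "finite I" "I \<subseteq> cball 0 (R + 2)" "cball 0 (R + 2) \<subseteq> (\<Union>i\<in>I. ball i (r i))"
  proof (rule compactE_image[of "cball 0 (R + 2)" "cball 0 (R + 2)" "\<lambda>i. ball i (r i)"])
    show "cball 0 (R + 2) \<subseteq> (\<Union>i\<in>cball 0 (R + 2). ball i (r i))" using r(1) by force
  qed auto
  \<comment> \<open>The weights \<open>\<phi> i\<close> cover \<open>cball 0 (R + 2)\<close> and
    \<open>\<psi>\<close> is positive beyond radius \<open>R + 1\<close>, so the total weight
    \<open>w\<close> has no zero.\<close>
  define \<phi> where "\<phi> = (\<lambda>i m. complex_of_real (max 0 (r i - dist i m)))"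
  define \<psi> where "\<psi> = (\<lambda>m :: complex. complex_of_real (max 0 (cmod m - (R + 1))))"
  define w where "w = (\<lambda>m. \<psi> m + (\<Sum>i\<in>I. \<phi> i m))"
  define P where "P = (\<lambda>(m, s). (\<psi> m * incr m (t0 / m) s + (\<Sum>i\<in>I. \<phi> i m * incr m (\<sigma> i) s)) / w m)"
  have w0: "w m \<noteq> 0" for m
  proof -
    let ?w = "max 0 (cmod m - (R + 1)) + (\<Sum>i\<in>I. max 0 (r i - dist i m))"
    have "?w > 0"
    proof (cases "cmod m \<le> R + 2")
      case True
      then obtain i where "i \<in> I" "m \<in> ball i (r i)" using I(3) by (auto simp: subset_iff)
      then show ?thesis using I(1)
        by (intro add_nonneg_pos sum_pos2[of I i]) auto
    next
      case False
      then show ?thesis by (intro add_pos_nonneg sum_nonneg) auto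
    qed
    moreover have "w m = of_real ?w" by (simp add: w_def \<phi>_def \<psi>_def)
    ultimately show ?thesis by (metis of_real_eq_0_iff less_irrefl)
  qed
  have \<phi>supp: "(m, \<sigma> i) \<in> X" if "\<phi> i m \<noteq> 0" for i m
    using that r(1)[of i] by (intro r(3)) (auto simp: \<phi>_def max_def split: if_splits)
  have \<psi>supp: "(m, t0 / m) \<in> X" if "\<psi> m \<noteq> 0" for m
    using that by (intro R(2)) (auto simp: \<psi>_def max_def split: if_splits)
  have contP: "isCont P (m, s)" if ms: "(m, s) \<in> X" for m s
  proof -
    have 1: "isCont (\<lambda>x. \<psi> (fst x) * (\<lambda>(m, s). incr m (t0 / m) s) x) (m, s)"
    proof (rule isCont_mult_locally_zero)
      show "isCont (\<lambda>x. \<psi> (fst x)) (m, s)"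
        unfolding \<psi>_def by (intro continuous_intros)
      \<comment> \<open>Where the base point leaves the slice the increment has no meaningful value,
        but there the weight vanishes on a whole neighbourhood.\<close>
      show "isCont (\<lambda>(m, s). incr m (t0 / m) s) (m, s) \<or> (\<forall>\<^sub>F y in nhds (m, s). \<psi> (fst y) = 0)"
      proof (cases "cmod m > R")
        case True
        then have "isCont (\<lambda>m. t0 / m) m" using R(1) by (intro continuous_intros) auto
        then show ?thesis using isCont_incr[of m "\<lambda>m. t0 / m", OF R(2)[OF True] ms] by blast
      next
        case False
        have "open {y :: complex \<times> complex. cmod (fst y) < R + 1}"
          by (intro open_Collect_less continuous_intros)
        then have "\<forall>\<^sub>F y in nhds (m, s). y \<in> {y. cmod (fst y) < R + 1}"
          using False by (intro eventually_nhds_in_open) auto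
        then have "\<forall>\<^sub>F y in nhds (m, s). \<psi> (fst y) = 0"
          by (rule eventually_mono) (auto simp: \<psi>_def)
        then show ?thesis ..
      qed
    qed
    have 2: "isCont (\<lambda>x. \<phi> i (fst x) * (\<lambda>(m, s). incr m (\<sigma> i) s) x) (m, s)" for i
    proof (rule isCont_mult_locally_zero)
      show "isCont (\<lambda>x. \<phi> i (fst x)) (m, s)"
        unfolding \<phi>_def by (intro continuous_intros)
      show "isCont (\<lambda>(m, s). incr m (\<sigma> i) s) (m, s) \<or> (\<forall>\<^sub>F y in nhds (m, s). \<phi> i (fst y) = 0)"
      proof (cases "m \<in> ball i (2 * r i)")
        case True
        then show ?thesis using isCont_incr[of m "\<lambda>_. \<sigma> i", OF r(3)[OF True] ms] by auto
      next
        case False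
        have "open {y :: complex \<times> complex. r i < dist i (fst y)}"
          by (intro open_Collect_less continuous_intros)
        then have "\<forall>\<^sub>F y in nhds (m, s). y \<in> {y. r i < dist i (fst y)}"
          using False r(1)[of i] by (intro eventually_nhds_in_open) auto
        then have "\<forall>\<^sub>F y in nhds (m, s). \<phi> i (fst y) = 0"
          by (rule eventually_mono) (auto simp: \<phi>_def)
        then show ?thesis ..
      qed
    qed
    have 3: "isCont (\<lambda>x. w (fst x)) (m, s)"
      unfolding w_def \<phi>_def \<psi>_def by (intro continuous_intros)
    have "P = (\<lambda>x. (\<psi> (fst x) * (\<lambda>(m, s). incr m (t0 / m) s) x +
        (\<Sum>i\<in>I. \<phi> i (fst x) * (\<lambda>(m, s). incr m (\<sigma> i) s) x)) / w (fst x))"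
      by (auto simp: P_def)
    moreover have "isCont (\<lambda>x. \<psi> (fst x) * (\<lambda>(m, s). incr m (t0 / m) s) x +
        (\<Sum>i\<in>I. \<phi> i (fst x) * (\<lambda>(m, s). incr m (\<sigma> i) s) x)) (m, s)"
      by (intro continuous_add continuous_sum 1 2)
    ultimately show ?thesis using isCont_divide[OF _ 3] w0[of m] by simp
  qed
  have P_diff: "exp (P (m, s)) / s = exp (P (m, s')) / s'" if "(m, s) \<in> X" "(m, s') \<in> X" for m s s'
  proof -
    obtain g where g: "\<And>s. (m, s) \<in> X \<Longrightarrow> exp (g s) = s" "\<And>a b. incr m a b = g b - g a"
      using incr_log[of m] by blast
    \<comment> \<open>The subtracted term averages \<open>g\<close> over the base points and does
      not involve \<open>s\<close>.\<close>
    have "P (m, s) = g s - (\<psi> m * g (t0 / m) + (\<Sum>i\<in>I. \<phi> i m * g (\<sigma> i))) / w m" for s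
    proof -
      have "\<psi> m * incr m (t0 / m) s + (\<Sum>i\<in>I. \<phi> i m * incr m (\<sigma> i) s) =
         w m * g s - (\<psi> m * g (t0 / m) + (\<Sum>i\<in>I. \<phi> i m * g (\<sigma> i)))"
        unfolding g(2) w_def
        by (simp add: algebra_simps sum_subtractf sum_distrib_left)
      then show ?thesis using w0[of m] by (simp add: P_def field_simps)
    qed
    then have "P (m, s) - P (m, s') = g s - g s'" by simp
    then have "exp (P (m, s)) / exp (P (m, s')) = s / s'"
      using g(1) that by (metis exp_diff)
    moreover have "s \<noteq> 0" "s' \<noteq> 0" using F0 that by (auto simp: F_def)
    ultimately show ?thesis by (simp add: field_simps)
  qed
  \<comment> \<open>By \<open>P_diff\<close> every point of the slice gives the same value, so jumps
    of \<open>\<sigma>\<close> do no harm.\<close>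
  define u where "u = (\<lambda>m. exp (P (m, \<sigma> m)) / \<sigma> m)"
  have \<sigma>0: "\<sigma> m \<noteq> 0" for m using F0[OF \<sigma>] by (simp add: F_def)
  have "continuous_on UNIV u"
  proof (intro continuous_at_imp_continuous_on ballI)
    fix m :: complex
    have "isCont (\<lambda>m'. P (m', \<sigma> m)) m"
      by (rule isCont_o2[where g=P and f="\<lambda>m'. (m', \<sigma> m)"])
        (use contP \<sigma> in \<open>auto intro!: continuous_intros\<close>)
    then have cont: "isCont (\<lambda>m'. exp (P (m', \<sigma> m)) / \<sigma> m) m"
      using \<sigma>0 by (intro continuous_intros) auto
    have "\<forall>\<^sub>F m' in nhds m. m' \<in> ball m (2 * r m)"
      using r(1)[of m] by (intro eventually_nhds_in_open) auto
    then have "\<forall>\<^sub>F m' in nhds m. exp (P (m', \<sigma> m)) / \<sigma> m = u m'"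
      by (rule eventually_mono) (use P_diff \<sigma> r(3) in \<open>auto simp: u_def\<close>)
    from isCont_cong[OF this] cont show "isCont u m" by blast
  qed
  moreover have "u m \<noteq> 0" for m using \<sigma>0 by (simp add: u_def)
  \<comment> \<open>Only \<open>\<psi>\<close> is active on this circle. Hence
    \<open>P (m, t0 / m)\<close> is the increment from \<open>t0 / m\<close> to itself, which is
    0.\<close>
  moreover have "u m = m / t0" if m: "cmod m = R + 4" for m
  proof -
    have X: "(m, t0 / m) \<in> X" using m by (intro R(2)) auto
    obtain g where g: "\<And>s. (m, s) \<in> X \<Longrightarrow> exp (g s) = s" "\<And>a b. incr m a b = g b - g a"
      using incr_log[of m] by blast
    have "\<phi> i m = 0" if "i \<in> I" for i
    proof -
      have "cmod i \<le> R + 2" using I(2) that by auto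
      moreover have "cmod m \<le> cmod i + dist i m"
        by (metis dist_norm norm_minus_commute norm_triangle_sub)
      ultimately show ?thesis using r(2)[of i] m by (simp add: \<phi>_def)
    qed
    then have "P (m, s) = incr m (t0 / m) s" for s
      using w0[of m] by (simp add: P_def w_def)
    then have "P (m, t0 / m) = 0" using g(2) by simp
    then have "exp (P (m, t0 / m)) / (t0 / m) = m / t0" by simp
    moreover have "u m = exp (P (m, t0 / m)) / (t0 / m)"
      unfolding u_def using X \<sigma> by (intro P_diff)
    ultimately show ?thesis by simp
  qed
  ultimately show False
    using no_log_near_infinity[of u "R + 4" t0] R(1) \<open>t0 \<noteq> 0\<close> by auto
qed

section \<open>Koebe's quarter theorem\<close>

text \<open>The library's change of variables theorem is stated for \<open>real ^ 'n\<close>, hence the transfer of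
  plane areas to \<open>real ^ 2\<close>.\<close>

definition complex_of_vec2 :: "real ^ 2 \<Rightarrow> complex"
  where "complex_of_vec2 x = Complex (x $ 1) (x $ 2)"

definition vec2_of_complex :: "complex \<Rightarrow> real ^ 2"
  where "vec2_of_complex z = vector [Re z, Im z]"

lemma vec2_of_complex_nth [simp]:
  "vec2_of_complex z $ 1 = Re z" "vec2_of_complex z $ 2 = Im z"
  by (simp_all add: vec2_of_complex_def)

lemma complex_of_vec2_sel [simp]:
  "Re (complex_of_vec2 x) = x $ 1" "Im (complex_of_vec2 x) = x $ 2"
  by (simp_all add: complex_of_vec2_def)

lemma vec2_complex_inverse [simp]:
  "complex_of_vec2 (vec2_of_complex z) = z" "vec2_of_complex (complex_of_vec2 x) = x"
  by (simp_all add: complex_eq_iff vec_eq_iff forall_2)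

lemma bounded_linear_vec2_of_complex: "bounded_linear vec2_of_complex"
  by (intro linear_conv_bounded_linear[THEN iffD1] linearI) (simp_all add: vec_eq_iff forall_2)

lemma bounded_linear_complex_of_vec2: "bounded_linear complex_of_vec2"
  by (intro linear_conv_bounded_linear[THEN iffD1] linearI) (simp_all add: complex_eq_iff)

lemma vec2_of_complex_image: "vec2_of_complex ` S = complex_of_vec2 -` S"
  by (force intro: image_eqI[where x="complex_of_vec2 _"])

lemma open_vec2_of_complex_image: "open S \<Longrightarrow> open (vec2_of_complex ` S)"
  unfolding vec2_of_complex_image
  by (intro open_vimage linear_continuous_on bounded_linear_complex_of_vec2)

lemma inj_vec2_of_complex: "inj vec2_of_complex"
  by (metis injI vec2_complex_inverse(1))

text \<open>By the Cauchy-Riemann equations the Jacobian determinant is the squared modulus of the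
  derivative. Boundedness gives the open image finite measure.\<close>

lemma area_image_holomorphic:
  assumes S: "open S" and hol: "f holomorphic_on S" and inj: "inj_on f S" and bd: "bounded (f ` S)"
  shows "vec2_of_complex ` f ` S \<in> lmeasurable"
    and "((\<lambda>x. (cmod (deriv f (complex_of_vec2 x)))\<^sup>2) has_integral
           measure lebesgue (vec2_of_complex ` f ` S)) (vec2_of_complex ` S)"
proof -
  let ?v = vec2_of_complex and ?c = complex_of_vec2
  have "open (f ` S)" using open_mapping_thm3[OF hol S inj] .
  moreover have "bounded (?v ` f ` S)"
    using bounded_linear_image[OF bd bounded_linear_vec2_of_complex] .
  ultimately show meas: "?v ` f ` S \<in> lmeasurable"
    by (intro lmeasurable_open open_vec2_of_complex_image)
  let ?f = "\<lambda>x. ?v (f (?c x))"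
  have im: "?f ` (?v ` S) = ?v ` f ` S" by (simp add: image_image)
  have der: "(?f has_derivative (\<lambda>h. ?v (deriv f (?c x) * ?c h))) (at x within ?v ` S)"
    if "x \<in> ?v ` S" for x
  proof -
    have "?c x \<in> S" using that by auto
    then have "(f has_derivative (*) (deriv f (?c x))) (at (?c x))"
      using holomorphic_derivI[OF hol S] by (simp add: has_field_derivative_def)
    moreover have "(?c has_derivative ?c) (at x within ?v ` S)"
      by (rule bounded_linear_imp_has_derivative[OF bounded_linear_complex_of_vec2])
    ultimately have "((\<lambda>x. f (?c x)) has_derivative (\<lambda>h. deriv f (?c x) * ?c h)) (at x within ?v ` S)"
      by (rule has_derivative_compose[rotated])
    then show ?thesis
      by (rule bounded_linear.has_derivative[OF bounded_linear_vec2_of_complex])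
  qed
  have det: "\<bar>det (matrix (\<lambda>h. ?v (d * ?c h)))\<bar> = (cmod d)\<^sup>2" for d
    unfolding cmod_power2 by (simp add: det_2 matrix_def axis_def power2_eq_square)
  have injf: "inj_on ?f (?v ` S)"
    using inj by (auto simp: inj_on_def inj_eq[OF inj_vec2_of_complex])
  have "?v ` S \<in> sets lebesgue" using open_vec2_of_complex_image[OF S] by (simp add: borel_open)
  from has_measure_differentiable_image[OF this der injf] meas
  show "((\<lambda>x. (cmod (deriv f (?c x)))\<^sup>2) has_integral measure lebesgue (?v ` f ` S)) (?v ` S)"
    unfolding im det by blast
qed

section \<open>Integrals over rectangles and circles\<close>

lemma measure_cbox_vec2:
  assumes "a \<le> b" "c \<le> d"
  shows "measure lborel (cbox (vector [a, c] :: real ^ 2) (vector [b, d])) = (b - a) * (d - c)"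
proof -
  have "cbox (vector [a, c] :: real ^ 2) (vector [b, d]) \<noteq> {}"
    using assms by (simp add: interval_ne_empty_cart forall_2)
  then show ?thesis by (simp add: content_cbox_cart UNIV_2)
qed

text \<open>Fubini's theorem with all inner integrals equal to \<open>J\<close>, carried from pairs
  to vectors by a coordinate change that preserves boxes and their areas.\<close>

lemma has_integral_vec2:
  fixes f :: "real \<times> real \<Rightarrow> complex"
  assumes ab: "a \<le> b" "c \<le> d" and cont: "continuous_on (cbox (a, c) (b, d)) f"
    and inner: "\<And>x. a \<le> x \<Longrightarrow> x \<le> b \<Longrightarrow> ((\<lambda>y. f (x, y)) has_integral J) {c..d}"
  shows "((\<lambda>x. f (x $ 1, x $ 2)) has_integral (of_real (b - a) * J))
    (cbox (vector [a, c] :: real ^ 2) (vector [b, d]))"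
proof -
  let ?g = "\<lambda>x :: real ^ 2. (x $ 1, x $ 2)" and ?h = "\<lambda>p. vector [fst p, snd p] :: real ^ 2"
  have im_h: "?h ` cbox u w = cbox (?h u) (?h w)" for u w :: "real \<times> real"
  proof -
    have "x \<in> ?h ` cbox u w" if "x \<in> cbox (?h u) (?h w)" for x
      using that by (cases u; cases w; intro image_eqI[where x="?g x"])
        (auto simp: mem_box_cart forall_2 vec_eq_iff cbox_Pair_eq)
    moreover have "x \<in> cbox (?h u) (?h w)" if "x \<in> ?h ` cbox u w" for x
      using that by (cases u; cases w) (auto simp: mem_box_cart forall_2 cbox_Pair_eq)
    ultimately show ?thesis by blast
  qed
  have im_g: "?g ` cbox u w = cbox (?g u) (?g w)" for u w :: "real ^ 2"
  proof -
    have "p \<in> ?g ` cbox u w" if "p \<in> cbox (?g u) (?g w)" for p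
      using that by (intro image_eqI[where x="?h p"]) (auto simp: mem_box_cart forall_2 cbox_Pair_eq)
    then show ?thesis by (auto simp: mem_box_cart forall_2 cbox_Pair_eq)
  qed
  have "integral (cbox (a, c) (b, d)) f = integral (cbox a b) (\<lambda>x. integral (cbox c d) (\<lambda>y. f (x, y)))"
    by (rule integral_prod_continuous[OF cont])
  also have "\<dots> = integral (cbox a b) (\<lambda>x. J)"
    using inner by (intro integral_cong) (auto intro!: integral_unique)
  also have "\<dots> = of_real (b - a) * J" using ab by (simp add: scaleR_conv_of_real)
  finally have "(f has_integral (of_real (b - a) * J)) (cbox (a, c) (b, d))"
    using integrable_integral[OF integrable_continuous[OF cont]] by simp
  then have "((\<lambda>x. f (?g x)) has_integral (1 / 1) *\<^sub>R (of_real (b - a) * J)) (?h ` cbox (a, c) (b, d))"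
  proof (rule has_integral_twiddle[rotated -1])
    show "measure lborel (?g ` cbox u w) = 1 * measure lborel (cbox u w)" for u w :: "real ^ 2"
    proof (cases "u $ 1 \<le> w $ 1 \<and> u $ 2 \<le> w $ 2")
      case True
      then have "cbox u w \<noteq> {}" by (simp add: interval_ne_empty_cart forall_2)
      with True show ?thesis unfolding im_g by (simp add: content_cbox_cart UNIV_2 content_Pair)
    next
      case False
      then have "cbox u w = {}" using interval_ne_empty_cart(1)[of u w] unfolding forall_2 by blast
      then show ?thesis by simp
    qed
  qed (use im_g im_h in \<open>auto simp: vec_eq_iff forall_2 intro!: continuous_intros exI\<close>)
  then show ?thesis by (simp add: im_h)
qed

text \<open>Cauchy's integral formula at the centre, where \<open>dz / z\<close> becomes
  \<open>\<i> dy\<close> on the circle.\<close>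

lemma has_integral_circle_mean:
  assumes p: "p holomorphic_on ball 0 1" and R: "0 < R" "R < 1"
  shows "((\<lambda>y. p (of_real R * cis y)) has_integral 2 * of_real pi * p 0) {0..2 * pi}"
proof -
  have "((\<lambda>z. p z / (z - 0)) has_contour_integral (2 * of_real pi * \<i> * p 0)) (circlepath 0 R)"
    using R by (intro Cauchy_integral_circlepath_simple holomorphic_on_subset[OF p]) auto
  then have "((\<lambda>t. p (0 + R * cis t) / (0 + R * cis t - 0) * R * \<i> * cis t) has_integral
      (2 * of_real pi * \<i> * p 0)) {0..2 * pi}"
    unfolding circlepath_def by (subst (asm) has_contour_integral_part_circlepath_iff) auto
  moreover have "p (0 + R * cis t) / (0 + R * cis t - 0) * R * \<i> * cis t = \<i> * p (R * cis t)" for t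
    using R by simp
  ultimately have "((\<lambda>t. \<i> * p (R * cis t)) has_integral (2 * of_real pi * \<i> * p 0)) {0..2 * pi}"
    by (simp only:)
  from has_integral_mult_right[OF this, of "-\<i>"]
  have "((\<lambda>t. p (R * cis t)) has_integral (- \<i> * (2 * of_real pi * \<i> * p 0))) {0..2 * pi}"
    by simp
  moreover have "- \<i> * (2 * of_real pi * \<i> * p 0) = 2 * of_real pi * p 0"
    by (simp add: complex_eq_iff)
  ultimately show ?thesis by (simp only:)
qed

text \<open>The exponential map wraps each vertical segment of the rectangle once around a circle,
  over which \<open>p\<close> has mean \<open>p 0\<close>.\<close>

lemma has_integral_log_strip:
  assumes p: "p holomorphic_on ball 0 1" and ab: "a \<le> b" "b < 0"
  shows "((\<lambda>x. p (exp (complex_of_vec2 x))) has_integral of_real ((b - a) * (2 * pi)) * p 0)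
    (cbox (vector [a, 0]) (vector [b, 2 * pi]))"
proof -
  have *: "exp (Complex x y) \<in> ball 0 1" if "x \<le> b" for x y
    using that ab by (simp add: norm_exp_eq_Re)
  have "continuous_on (cbox (a, 0) (b, 2 * pi)) (\<lambda>q. p (exp (Complex (fst q) (snd q))))"
  proof (rule continuous_on_compose2[OF holomorphic_on_imp_continuous_on[OF p]])
    show "continuous_on (cbox (a, 0) (b, 2 * pi)) (\<lambda>q. exp (Complex (fst q) (snd q)))"
      unfolding Complex_eq by (intro continuous_intros)
    show "(\<lambda>q. exp (Complex (fst q) (snd q))) ` cbox (a, 0) (b, 2 * pi) \<subseteq> ball 0 1"
      using * by (force simp: cbox_Pair_eq)
  qed
  moreover have "((\<lambda>y. p (exp (Complex (fst (x, y)) (snd (x, y))))) has_integral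
      2 * of_real pi * p 0) {0..2 * pi}" if "x \<le> b" for x
    using has_integral_circle_mean[OF p, of "exp x"] that ab by (simp add: exp_eq_polar)
  ultimately have "((\<lambda>x :: real ^ 2. p (exp (Complex (fst (x $ 1, x $ 2)) (snd (x $ 1, x $ 2)))))
      has_integral of_real (b - a) * (2 * of_real pi * p 0)) (cbox (vector [a, 0]) (vector [b, 2 * pi]))"
    by (intro has_integral_vec2 ab) auto
  then show ?thesis by (simp add: complex_of_vec2_def mult_ac)
qed

section \<open>Univalent functions near a zero and preimages of a slit\<close>

lemma univalent_log_holomorphic_at_0:
  assumes h: "h holomorphic_on ball 0 1" "inj_on h (ball 0 1)" "h 0 = 0"
  obtains p where "p holomorphic_on ball 0 1" "p 0 = 1"
    "\<And>z. z \<in> ball 0 1 \<Longrightarrow> z \<noteq> 0 \<Longrightarrow> p z = z * deriv h z / h z"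
proof -
  \<comment> \<open>\<open>H\<close> is \<open>h z / z\<close> with the singularity filled by
    \<open>deriv h 0\<close>, which is nonzero by injectivity. Thus \<open>deriv h z / H z\<close>
    extends the logarithmic derivative \<open>z h' / h\<close> across 0 with value 1.\<close>
  define H where "H = (\<lambda>z. if z = 0 then deriv h 0 else (h z - h 0) / (z - 0))"
  have H: "H holomorphic_on ball 0 1"
    unfolding H_def by (rule pole_lemma[OF h(1)]) simp
  have d0: "deriv h 0 \<noteq> 0"
    using holomorphic_injective_imp_regular[OF h(1) _ h(2), of 0] by simp
  have "h z \<noteq> 0" if "z \<in> ball 0 1" "z \<noteq> 0" for z
    using h(2,3) that by (metis centre_in_ball inj_onD zero_less_one)
  then have H0: "H z \<noteq> 0" if "z \<in> ball 0 1" for z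
    using d0 h(3) that by (auto simp: H_def)
  have "(\<lambda>z. deriv h z / H z) holomorphic_on ball 0 1"
    using h(1) H H0 by (intro holomorphic_intros holomorphic_deriv) auto
  then show ?thesis
    using d0 h(3) by (intro that[of "\<lambda>z. deriv h z / H z"]) (auto simp: H_def)
qed

text \<open>The inverse of \<open>h\<close> has derivative of modulus below 1 at 0, so near 0 it
  shrinks moduli by a factor \<open>\<kappa> < 1\<close>: values of modulus below
  \<open>\<epsilon>\<close> are attained only inside radius \<open>\<kappa> * \<epsilon>\<close>.
  This gap drives the area contradiction below.\<close>

lemma univalent_image_near_0:
  assumes h: "h holomorphic_on ball 0 1" "inj_on h (ball 0 1)" "h 0 = 0"
    and d: "cmod (deriv h 0) > 1"
  obtains \<kappa> \<epsilon> where "0 < \<kappa>" "\<kappa> < 1" "0 < \<epsilon>" "\<epsilon> < 1"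
    "ball 0 \<epsilon> \<subseteq> h ` ball 0 1"
    "\<And>z. z \<in> ball 0 1 \<Longrightarrow> \<kappa> * \<epsilon> \<le> cmod z \<Longrightarrow> \<epsilon> \<le> cmod (h z)"
proof -
  obtain g where g: "g holomorphic_on (h ` ball 0 1)"
    "\<And>z. z \<in> ball 0 1 \<Longrightarrow> deriv h z * deriv g (h z) = 1" "\<And>z. z \<in> ball 0 1 \<Longrightarrow> g (h z) = z"
    using holomorphic_has_inverse[OF h(1) open_ball h(2)] by blast
  have op: "open (h ` ball 0 1)" using open_mapping_thm3[OF h(1) open_ball h(2)] .
  have 0: "0 \<in> h ` ball 0 1" using h(3) by (metis centre_in_ball image_eqI zero_less_one)
  have g0: "g 0 = 0" using g(3)[of 0] h(3) by simp
  have "deriv h 0 * deriv g 0 = 1" using g(2)[of 0] h(3) by simp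
  then have "cmod (deriv h 0) * cmod (deriv g 0) = 1" by (metis norm_mult norm_one)
  then have dg: "cmod (deriv g 0) < 1" using d
    by (smt (verit) mult_le_cancel_left1 norm_ge_zero mult.commute mult_less_cancel_right1)
  \<comment> \<open>The midpoint between \<open>cmod (deriv g 0)\<close> and 1 leaves a margin to
    absorb the linearisation error of \<open>g\<close>.\<close>
  define \<kappa> where "\<kappa> = (1 + cmod (deriv g 0)) / 2"
  have \<kappa>: "cmod (deriv g 0) < \<kappa>" "\<kappa> < 1" "0 < \<kappa>"
    using dg by (auto simp: \<kappa>_def intro: add_pos_nonneg)
  have "(g has_derivative (*) (deriv g 0)) (at 0)"
    using holomorphic_derivI[OF g(1) op 0] by (simp add: has_field_derivative_def)
  then obtain e where e: "e > 0" "\<And>w. cmod w < e \<Longrightarrow> cmod (g w - deriv g 0 * w) \<le> (\<kappa> - cmod (deriv g 0)) * cmod w"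
    unfolding has_derivative_at_alt using \<kappa>(1) g0 by (metis diff_gt_0_iff_gt diff_zero)
  obtain e' where e': "e' > 0" "ball 0 e' \<subseteq> h ` ball 0 1" using op 0 by (metis openE)
  define \<epsilon> where "\<epsilon> = min (1/2) (min e e')"
  have \<epsilon>: "0 < \<epsilon>" "\<epsilon> < 1" "\<epsilon> \<le> e" "\<epsilon> \<le> e'" using e(1) e'(1) by (auto simp: \<epsilon>_def)
  show ?thesis
  proof (rule that[of \<kappa> \<epsilon>])
    show "ball 0 \<epsilon> \<subseteq> h ` ball 0 1" using e'(2) \<epsilon>(4) by auto
    fix z assume z: "z \<in> ball 0 1" "\<kappa> * \<epsilon> \<le> cmod z"
    show "\<epsilon> \<le> cmod (h z)"
    proof (rule ccontr)
      assume *: "\<not> \<epsilon> \<le> cmod (h z)"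
      have "cmod z = cmod (g (h z))" using g(3)[OF z(1)] by simp
      also have "\<dots> \<le> cmod (g (h z) - deriv g 0 * h z) + cmod (deriv g 0 * h z)"
        by (metis norm_triangle_sub add.commute)
      also have "\<dots> \<le> (\<kappa> - cmod (deriv g 0)) * cmod (h z) + cmod (deriv g 0) * cmod (h z)"
        using e(2)[of "h z"] * \<epsilon>(3) by (simp add: norm_mult)
      also have "\<dots> = \<kappa> * cmod (h z)" by (simp add: algebra_simps)
      also have "\<dots> < \<kappa> * \<epsilon>" using * \<kappa>(3) by simp
      finally show False using z(2) by simp
    qed
  qed (use \<kappa> \<epsilon> in auto)
qed

text \<open>The preimage lies in the image of a piece of the real axis
  \<open>{w. \<i> \<bullet> w = 0}\<close> under the holomorphic inverse of \<open>k\<close>, and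
  differentiable maps preserve null sets. Removing it makes the principal logarithm of
  \<open>k\<close> holomorphic.\<close>

lemma negligible_preimage_slit:
  assumes S: "open S" and k: "k holomorphic_on S" "inj_on k S"
  shows "negligible (vec2_of_complex ` {z\<in>S. k z \<in> \<real>\<^sub>\<le>\<^sub>0})"
proof -
  obtain g where g: "g holomorphic_on (k ` S)" "\<And>z. z \<in> S \<Longrightarrow> g (k z) = z"
    by (rule holomorphic_has_inverse[OF k(1) S k(2)]) blast
  let ?N = "k ` S \<inter> {w. \<i> \<bullet> w = 0}"
  have op: "open (k ` S)" using open_mapping_thm3[OF k(1) S k(2)] .
  have "negligible ?N"
    using negligible_Int[OF disjI2[OF negligible_hyperplane[of \<i> 0]], of "k ` S"] by simp
  moreover have "(\<lambda>w. vec2_of_complex (g w)) differentiable_on ?N"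
  proof (rule differentiable_on_subset)
    show "(\<lambda>w. vec2_of_complex (g w)) differentiable_on k ` S"
      unfolding differentiable_on_def
    proof
      fix w assume "w \<in> k ` S"
      from holomorphic_derivI[OF g(1) op this]
      have "(g has_derivative (*) (deriv g w)) (at w within k ` S)"
        by (simp add: has_field_derivative_def has_derivative_at_withinI)
      from bounded_linear.has_derivative[OF bounded_linear_vec2_of_complex this]
      show "(\<lambda>w. vec2_of_complex (g w)) differentiable at w within k ` S"
        unfolding differentiable_def by blast
    qed
  qed simp
  ultimately have "negligible ((\<lambda>w. vec2_of_complex (g w)) ` ?N)"
    by (intro negligible_differentiable_image_negligible) auto
  then show ?thesis
  proof (rule negligible_subset, clarify)
    fix z assume z: "z \<in> S" "k z \<in> \<real>\<^sub>\<le>\<^sub>0"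
    then have "k z \<in> ?N" by (auto simp: complex_nonpos_Reals_iff inner_complex_def)
    then show "vec2_of_complex z \<in> (\<lambda>w. vec2_of_complex (g w)) ` ?N"
      by (rule rev_image_eqI) (simp add: g(2)[OF z(1)])
  qed
qed

text \<open>Length-area argument in logarithmic coordinates. If \<open>\<bar>h' 0\<bar> > 1\<close>, then \<open>\<Phi> = log \<circ> h \<circ> exp\<close> maps a
  rectangle of area \<open>2 \<pi> (b - a)\<close> injectively into the box \<open>\<bar>Re\<bar> \<le> L\<close>, \<open>\<bar>Im\<bar> \<le> \<pi>\<close> with
  \<open>L < b - a\<close>. The image has at least the same area, because \<open>\<bar>\<Phi>'\<bar>\<^sup>2 \<ge> 2 Re \<Phi>' - 1\<close> and \<open>\<Phi>'\<close> has mean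
  value 1, and it is disjoint from its reflection in 0, so that the box would be too small.\<close>

lemma deriv_le_1_of_disjoint_inverse:
  assumes h: "h holomorphic_on ball 0 1" "inj_on h (ball 0 1)" "h 0 = 0"
    and hh: "\<And>z w. z \<in> ball 0 1 \<Longrightarrow> w \<in> ball 0 1 \<Longrightarrow> h z * h w \<noteq> 1"
  shows "cmod (deriv h 0) \<le> 1"
proof (rule ccontr)
  assume "\<not> ?thesis"
  then have "cmod (deriv h 0) > 1" by simp
  from univalent_image_near_0[OF h this] obtain \<kappa> \<epsilon> where \<kappa>: "0 < \<kappa>" "\<kappa> < 1"
    and \<epsilon>: "0 < \<epsilon>" "\<epsilon> < 1" and U: "ball 0 \<epsilon> \<subseteq> h ` ball 0 1"
    and low: "\<And>z. z \<in> ball 0 1 \<Longrightarrow> \<kappa> * \<epsilon> \<le> cmod z \<Longrightarrow> \<epsilon> \<le> cmod (h z)" by blast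
  \<comment> \<open>A larger value would put \<open>1 / h z\<close> into
    \<open>ball 0 \<epsilon>\<close>, hence among the values of \<open>h\<close>, against
    \<open>hh\<close>.\<close>
  have up: "cmod (h z) \<le> 1 / \<epsilon>" if "z \<in> ball 0 1" for z
  proof (rule ccontr)
    assume "\<not> ?thesis"
    then have *: "1 / \<epsilon> < cmod (h z)" by simp
    then have 0: "h z \<noteq> 0" using \<epsilon> by auto
    have "1 / h z \<in> ball 0 \<epsilon>" using * 0 \<epsilon> by (simp add: norm_divide field_simps)
    then obtain w where w: "w \<in> ball 0 1" "h w = 1 / h z" using U by (metis imageE subsetD)
    with hh[OF that w(1)] 0 show False by simp
  qed
  obtain p where p: "p holomorphic_on ball 0 1" "p 0 = 1"
    "\<And>z. z \<in> ball 0 1 \<Longrightarrow> z \<noteq> 0 \<Longrightarrow> p z = z * deriv h z / h z"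
    using univalent_log_holomorphic_at_0[OF h] by blast
  have h0: "h z \<noteq> 0" if "z \<in> ball 0 1" "z \<noteq> 0" for z
    using h(2,3) that by (metis centre_in_ball inj_onD zero_less_one)
  \<comment> \<open>The bound \<open>low\<close> applies from
    \<open>exp a = \<kappa> * \<epsilon>\<close> on, and \<open>b < 0\<close> keeps
    \<open>exp z\<close> inside the unit disc. Since \<open>b > ln \<kappa>\<close>, the width
    \<open>b - a\<close> exceeds \<open>- ln \<epsilon> = L\<close>.\<close>
  define a b L where "a = ln (\<kappa> * \<epsilon>)" and "b = ln ((1 + \<kappa>) / 2)" and "L = - ln \<epsilon>"
  have ab: "a \<le> b" "b < 0"
  proof -
    have "\<kappa> * \<epsilon> \<le> \<kappa> * 1" using \<kappa> \<epsilon> by (intro mult_left_mono) auto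
    also have "\<dots> \<le> (1 + \<kappa>) / 2" using \<kappa> by simp
    finally show "a \<le> b" unfolding a_def b_def using \<kappa> \<epsilon> by (subst ln_le_cancel_iff) auto
    show "b < 0" using \<kappa> by (auto simp: b_def)
  qed
  \<comment> \<open>Height 2 pi makes \<open>exp\<close> injective on \<open>T\<close>;
    \<open>T'\<close> below omits the points that \<open>k\<close> sends to the branch cut.\<close>
  define T where "T = {z. a < Re z \<and> Re z < b \<and> 0 < Im z \<and> Im z < 2 * pi}"
  define k where "k = (\<lambda>z. h (exp z))"
  define T' where "T' = T - {z\<in>T. k z \<in> \<real>\<^sub>\<le>\<^sub>0}"
  define \<Phi> where "\<Phi> = (\<lambda>z. Ln (k z))"
  let ?v = vec2_of_complex
  have exp_ball: "exp z \<in> ball 0 1" if "z \<in> T" for z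
    using that ab by (simp add: T_def norm_exp_eq_Re)
  have opT: "open T"
    unfolding T_def by (intro open_Collect_conj open_Collect_less continuous_intros)
  have kT: "k holomorphic_on T"
    unfolding k_def using exp_ball
    by (intro holomorphic_on_compose_gen[OF _ h(1), unfolded o_def] holomorphic_intros) auto
  have injk: "inj_on k T"
  proof (rule inj_onI)
    fix z w assume zw: "z \<in> T" "w \<in> T" "k z = k w"
    then have "exp z = exp w" using h(2) exp_ball unfolding k_def by (metis inj_onD)
    moreover have "\<bar>Im z - Im w\<bar> < 2 * pi" using zw by (auto simp: T_def)
    ultimately show "z = w" by (rule exp_complex_eqI[rotated])
  qed
  have T'_T: "T' \<subseteq> T" by (auto simp: T'_def)
  have opT': "open T'"
  proof -
    have "open (T \<inter> k -` (- \<real>\<^sub>\<le>\<^sub>0))"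
      by (intro continuous_open_preimage[OF holomorphic_on_imp_continuous_on[OF kT] opT]) auto
    also have "T \<inter> k -` (- \<real>\<^sub>\<le>\<^sub>0) = T'" by (auto simp: T'_def)
    finally show ?thesis .
  qed
  have k_slit: "k z \<notin> \<real>\<^sub>\<le>\<^sub>0" "k z \<noteq> 0" if "z \<in> T'" for z
    using that by (auto simp: T'_def)
  have hol: "\<Phi> holomorphic_on T'"
    unfolding \<Phi>_def using k_slit by (intro holomorphic_intros holomorphic_on_subset[OF kT T'_T]) auto
  have exp\<Phi>: "exp (\<Phi> z) = k z" if "z \<in> T'" for z
    using k_slit[OF that] by (simp add: \<Phi>_def)
  have inj: "inj_on \<Phi> T'"
    using injk exp\<Phi> T'_T by (metis inj_onI inj_onD subsetD)
  have der: "deriv \<Phi> z = p (exp z)" if z: "z \<in> T'" for z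
  proof -
    have e: "exp z \<in> ball 0 1" using z T'_T exp_ball by blast
    have "(h has_field_derivative deriv h (exp z)) (at (exp z))"
      by (rule holomorphic_derivI[OF h(1) _ e]) simp
    then have "(k has_field_derivative deriv h (exp z) * exp z) (at z)"
      unfolding k_def by (rule DERIV_chain2[OF _ DERIV_exp])
    then have "(\<Phi> has_field_derivative (deriv h (exp z) * exp z) / k z) (at z)"
      unfolding \<Phi>_def using k_slit[OF z] by (auto intro!: derivative_eq_intros simp: field_simps)
    then show ?thesis using p(3)[OF e] by (simp add: DERIV_imp_deriv k_def mult_ac)
  qed
  have box: "\<bar>Re (\<Phi> z)\<bar> \<le> L" "\<bar>Im (\<Phi> z)\<bar> \<le> pi" if z: "z \<in> T'" for z
  proof -
    have e: "exp z \<in> ball 0 1" using z T'_T exp_ball by blast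
    have "\<kappa> * \<epsilon> = exp a" using \<kappa> \<epsilon> by (simp add: a_def)
    also have "\<dots> \<le> cmod (exp z)" using z T'_T by (auto simp: T_def norm_exp_eq_Re)
    finally have "\<epsilon> \<le> cmod (k z)" unfolding k_def using low[OF e] by simp
    moreover have "cmod (k z) \<le> 1 / \<epsilon>" unfolding k_def using up[OF e] .
    ultimately have "ln \<epsilon> \<le> ln (cmod (k z))" "ln (cmod (k z)) \<le> ln (1 / \<epsilon>)"
      using \<epsilon> k_slit(2)[OF z] by (auto simp: ln_le_cancel_iff)
    moreover have "Re (\<Phi> z) = ln (cmod (k z))" using k_slit(2)[OF z] by (simp add: \<Phi>_def)
    ultimately show "\<bar>Re (\<Phi> z)\<bar> \<le> L" using \<epsilon> by (auto simp: L_def ln_div)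
    show "\<bar>Im (\<Phi> z)\<bar> \<le> pi" unfolding \<Phi>_def
      using Im_Ln_le_pi[OF k_slit(2)[OF z]] mpi_less_Im_Ln[OF k_slit(2)[OF z]] by auto
  qed
  have bd: "bounded (\<Phi> ` T')"
  proof (rule boundedI)
    fix w assume "w \<in> \<Phi> ` T'"
    then show "cmod w \<le> L + pi" using box cmod_le[of w] by fastforce
  qed
  \<comment> \<open>The map \<open>- \<Phi>\<close> is a logarithm of \<open>1 / k\<close>. Its
    derivative has the same modulus, so its image has the same area as that of
    \<open>\<Phi>\<close>.\<close>
  have neg_hol: "(\<lambda>z. - \<Phi> z) holomorphic_on T'" using hol by (intro holomorphic_intros)
  have neg_inj: "inj_on (\<lambda>z. - \<Phi> z) T'" using inj by (simp add: inj_on_def)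
  have neg_bd: "bounded ((\<lambda>z. - \<Phi> z) ` T')"
    using bounded_uminus bd by (metis image_image)
  have neg_der: "deriv (\<lambda>z. - \<Phi> z) z = - p (exp z)" if "z \<in> T'" for z
  proof -
    have "(\<Phi> has_field_derivative deriv \<Phi> z) (at z)" by (rule holomorphic_derivI[OF hol opT' that])
    then have "((\<lambda>z. - \<Phi> z) has_field_derivative - deriv \<Phi> z) (at z)" by (rule DERIV_minus)
    then show ?thesis using der[OF that] DERIV_imp_deriv by simp
  qed
  let ?A = "?v ` \<Phi> ` T'" and ?B = "?v ` (\<lambda>z. - \<Phi> z) ` T'"
  let ?c = complex_of_vec2
  have A: "?A \<in> lmeasurable" "((\<lambda>x. (cmod (p (exp (?c x))))\<^sup>2) has_integral measure lebesgue ?A) (?v ` T')"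
  proof -
    note * = area_image_holomorphic[OF opT' hol inj bd]
    from *(1) show "?A \<in> lmeasurable" .
    show "((\<lambda>x. (cmod (p (exp (?c x))))\<^sup>2) has_integral measure lebesgue ?A) (?v ` T')"
      by (rule has_integral_eq[OF _ *(2)]) (auto simp: der)
  qed
  have B: "?B \<in> lmeasurable" "((\<lambda>x. (cmod (p (exp (?c x))))\<^sup>2) has_integral measure lebesgue ?B) (?v ` T')"
  proof -
    note * = area_image_holomorphic[OF opT' neg_hol neg_inj neg_bd]
    from *(1) show "?B \<in> lmeasurable" .
    show "((\<lambda>x. (cmod (p (exp (?c x))))\<^sup>2) has_integral measure lebesgue ?B) (?v ` T')"
      by (rule has_integral_eq[OF _ *(2)]) (auto simp: neg_der)
  qed
  have eqAB: "measure lebesgue ?B = measure lebesgue ?A"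
    using has_integral_unique[OF B(2) A(2)] .
  have disj: "?A \<inter> ?B = {}"
  proof -
    have "\<Phi> z \<noteq> - \<Phi> w" if "z \<in> T'" "w \<in> T'" for z w
    proof
      assume "\<Phi> z = - \<Phi> w"
      then have "exp (\<Phi> z) * exp (\<Phi> w) = 1" by (simp flip: exp_add)
      then have "h (exp z) * h (exp w) = 1" using exp\<Phi> that by (simp add: k_def)
      moreover have "exp z \<in> ball 0 1" "exp w \<in> ball 0 1" using that T'_T exp_ball by blast+
      ultimately show False using hh by blast
    qed
    then show ?thesis by (auto simp: inj_eq[OF inj_vec2_of_complex])
  qed
  let ?R = "cbox (vector [- L, - pi] :: real ^ 2) (vector [L, pi])"
  have L: "0 \<le> L" using \<epsilon> by (simp add: L_def)
  have "?A \<union> ?B \<subseteq> ?R"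
    using box by (fastforce simp: mem_box_cart forall_2 abs_le_iff)
  then have "measure lebesgue (?A \<union> ?B) \<le> measure lebesgue ?R"
    using A(1) B(1) by (intro measure_mono_fmeasurable) auto
  moreover have "measure lebesgue (?A \<union> ?B) = measure lebesgue ?A + measure lebesgue ?B"
    using A(1) B(1) disj by (intro measure_Un3[THEN trans]) (auto simp: fmeasurableD)
  moreover have "measure lebesgue ?R = (2 * L) * (2 * pi)"
    using measure_cbox_vec2[of "- L" L "- pi" pi] L by simp
  ultimately have area_le: "measure lebesgue ?A \<le> L * (2 * pi)" using eqAB by (simp add: mult_ac)
  let ?Q = "cbox (vector [a, 0] :: real ^ 2) (vector [b, 2 * pi])"
  \<comment> \<open>\<open>?q \<le> \<bar>p\<bar>^2\<close> amounts to
    \<open>0 \<le> \<bar>p - 1\<bar>^2\<close>, and \<open>?q\<close> has mean 1 because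
    \<open>p 0 = 1\<close>.\<close>
  let ?q = "\<lambda>x. 2 * Re (p (exp (?c x))) - 1"
  have "((\<lambda>x. p (exp (?c x))) has_integral of_real ((b - a) * (2 * pi)) * p 0) ?Q"
    by (rule has_integral_log_strip[OF p(1) ab])
  from has_integral_linear[OF this bounded_linear_Re]
  have "((\<lambda>x. Re (p (exp (?c x)))) has_integral (b - a) * (2 * pi)) ?Q"
    by (simp add: o_def p(2))
  moreover have "((\<lambda>x. 1 :: real) has_integral (b - a) * (2 * pi)) ?Q"
    using has_integral_const[of "1::real" "vector [a, 0] :: real ^ 2" "vector [b, 2 * pi]"]
      measure_cbox_vec2[of a b 0 "2 * pi"] ab by simp
  ultimately have "(?q has_integral 2 * ((b - a) * (2 * pi)) - (b - a) * (2 * pi)) ?Q"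
    by (intro has_integral_diff has_integral_mult_right)
  moreover have "2 * ((b - a) * (2 * pi)) - (b - a) * (2 * pi) = (b - a) * (2 * pi)" by simp
  ultimately have q: "(?q has_integral (b - a) * (2 * pi)) ?Q" by (simp only:)
  have neg: "negligible ((?Q - box (vector [a, 0]) (vector [b, 2 * pi])) \<union> ?v ` {z\<in>T. k z \<in> \<real>\<^sub>\<le>\<^sub>0})"
    using negligible_frontier_interval negligible_preimage_slit[OF opT kT injk]
    by (intro negligible_Un) auto
  have Q_diff: "?Q - ?v ` T' \<subseteq>
      (?Q - box (vector [a, 0]) (vector [b, 2 * pi])) \<union> ?v ` {z\<in>T. k z \<in> \<real>\<^sub>\<le>\<^sub>0}"
  proof
    fix x assume x: "x \<in> ?Q - ?v ` T'"
    show "x \<in> (?Q - box (vector [a, 0]) (vector [b, 2 * pi])) \<union> ?v ` {z\<in>T. k z \<in> \<real>\<^sub>\<le>\<^sub>0}"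
    proof (cases "x \<in> box (vector [a, 0]) (vector [b, 2 * pi])")
      case True
      then have "?c x \<in> T" by (auto simp: T_def mem_box_cart forall_2)
      moreover have "?c x \<notin> T'" using x by (metis DiffD2 image_eqI vec2_complex_inverse(2))
      ultimately have "?c x \<in> {z\<in>T. k z \<in> \<real>\<^sub>\<le>\<^sub>0}" by (auto simp: T'_def)
      then have "?v (?c x) \<in> ?v ` {z\<in>T. k z \<in> \<real>\<^sub>\<le>\<^sub>0}" by (rule imageI)
      then show ?thesis by simp
    qed (use x in auto)
  qed
  have diff_Q: "?v ` T' - ?Q = {}"
    using T'_T by (auto simp: T_def mem_box_cart forall_2)
  \<comment> \<open>The closed rectangle and \<open>T'\<close> differ only by the edges and the
    preimage of the slit.\<close>
  have "(?q has_integral (b - a) * (2 * pi)) ?Q \<longleftrightarrow> (?q has_integral (b - a) * (2 * pi)) (?v ` T')"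
  proof (rule has_integral_spike_set_eq)
    show "negligible {x \<in> ?Q - ?v ` T'. ?q x \<noteq> 0}"
      by (rule negligible_subset[OF neg]) (use Q_diff in blast)
    show "negligible {x \<in> ?v ` T' - ?Q. ?q x \<noteq> 0}"
      unfolding diff_Q by simp
  qed
  with q have "(?q has_integral (b - a) * (2 * pi)) (?v ` T')" by blast
  moreover have "?q x \<le> (cmod (p (exp (?c x))))\<^sup>2" for x
  proof -
    have "0 \<le> (Re (p (exp (?c x))) - 1)\<^sup>2 + (Im (p (exp (?c x))))\<^sup>2" by simp
    then show ?thesis unfolding cmod_power2 by (simp add: power2_diff)
  qed
  ultimately have "(b - a) * (2 * pi) \<le> measure lebesgue ?A"
    using A(2) has_integral_le by blast
  from order_trans[OF this area_le] have "b - a \<le> L" by (rule mult_right_le_imp_le) simp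
  then have "ln ((1 + \<kappa>) / 2) \<le> ln \<kappa>"
    using \<kappa> \<epsilon> by (simp add: a_def b_def L_def ln_mult)
  then have "(1 + \<kappa>) / 2 \<le> \<kappa>" using \<kappa> by (subst (asm) ln_le_cancel_iff) auto
  with \<kappa> show False by simp
qed

text \<open>The Cayley transform of the square root of \<open>G\<close> satisfies the hypotheses of the previous lemma:
  \<open>q\<close> never takes opposite values, and \<open>q \<mapsto> - q\<close> corresponds to \<open>h \<mapsto> 1 / h\<close>.\<close>

lemma univalent_nonvanishing_deriv_le:
  assumes G: "G holomorphic_on ball 0 1" "inj_on G (ball 0 1)" "G 0 = 1"
    and G0: "\<And>z. z \<in> ball 0 1 \<Longrightarrow> G z \<noteq> 0"
  shows "cmod (deriv G 0) \<le> 4"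
proof -
  obtain g where g: "g holomorphic_on ball 0 1" "\<And>z. z \<in> ball 0 1 \<Longrightarrow> G z = exp (g z)"
    using contractible_imp_holomorphic_log[OF G(1) convex_imp_contractible[OF convex_ball] G0] by metis
  \<comment> \<open>Halving a logarithm gives the square root of \<open>G\<close> with value 1 at
    0.\<close>
  define q where "q = (\<lambda>z. exp ((g z - g 0) / 2))"
  define h where "h = (\<lambda>z. (q z - 1) / (q z + 1))"
  have q2: "(q z)\<^sup>2 = G z" if "z \<in> ball 0 1" for z
  proof -
    have "(q z)\<^sup>2 = exp (2 * ((g z - g 0) / 2))" unfolding q_def by (rule exp_double[symmetric])
    also have "\<dots> = exp (g z - g 0)" by (simp add: diff_divide_distrib)
    also have "\<dots> = G z / G 0" using g(2)[OF that] g(2)[of 0] by (simp add: exp_diff)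
    finally show ?thesis using G(3) by simp
  qed
  have q0: "q 0 = 1" by (simp add: q_def)
  have hq: "q holomorphic_on ball 0 1" unfolding q_def using g(1) by (intro holomorphic_intros) auto
  \<comment> \<open>Either relation gives equal squares \<open>G z = G w\<close>, so
    \<open>z = w\<close> by injectivity of \<open>G\<close>.\<close>
  have q_eq: "z = w \<and> q z = q w" if "z \<in> ball 0 1" "w \<in> ball 0 1" "q z = q w \<or> q z = - q w" for z w
  proof -
    have "G z = G w" using q2 that by (metis power2_minus)
    then have "z = w" using G(2) that by (metis inj_onD)
    then show ?thesis by simp
  qed
  have qne: "q z \<noteq> 0" for z by (simp add: q_def)
  have q_neg: "q z \<noteq> - q w" if "z \<in> ball 0 1" "w \<in> ball 0 1" for z w
  proof
    assume *: "q z = - q w"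
    then have "q z = q w" using q_eq[OF that] by blast
    with * have "2 * q w = 0" by (simp add: eq_neg_iff_add_eq_0)
    then show False using qne by simp
  qed
  have q1: "q z + 1 \<noteq> 0" if "z \<in> ball 0 1" for z
    using q_neg[OF that, of 0] q0 by (simp add: eq_neg_iff_add_eq_0)
  have hh: "h holomorphic_on ball 0 1" unfolding h_def using hq q1 by (intro holomorphic_intros) auto
  have injh: "inj_on h (ball 0 1)"
  proof (rule inj_onI)
    fix z w assume zw: "z \<in> ball 0 1" "w \<in> ball 0 1" "h z = h w"
    then have "(q z - 1) * (q w + 1) = (q w - 1) * (q z + 1)"
      using q1 by (simp add: h_def frac_eq_eq)
    then have "q z = q w" by (simp add: algebra_simps)
    then show "z = w" using q_eq zw by blast
  qed
  have prod: "h z * h w \<noteq> 1" if "z \<in> ball 0 1" "w \<in> ball 0 1" for z w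
  proof
    assume "h z * h w = 1"
    then have "(q z - 1) * (q w - 1) = (q z + 1) * (q w + 1)"
      using q1 that by (simp add: h_def divide_eq_eq)
    then have "2 * (q z + q w) = 0" by (simp add: algebra_simps)
    then have "q z + q w = 0" by (simp only: mult_eq_0_iff) simp
    then show False using q_neg[OF that] by (simp add: eq_neg_iff_add_eq_0)
  qed
  have "cmod (deriv h 0) \<le> 1"
    using deriv_le_1_of_disjoint_inverse[OF hh injh _ prod] q0 by (simp add: h_def)
  have dq: "(q has_field_derivative deriv q 0) (at 0)"
    by (rule holomorphic_derivI[OF hq]) auto
  have "(h has_field_derivative deriv q 0 / 2) (at 0)"
    unfolding h_def using q0
    by (auto intro!: derivative_eq_intros dq simp: field_simps)
  then have dh: "deriv h 0 = deriv q 0 / 2" by (rule DERIV_imp_deriv)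
  have "((\<lambda>z. (q z)\<^sup>2) has_field_derivative 2 * deriv q 0) (at 0)"
    using q0 by (auto intro!: derivative_eq_intros dq)
  then have "(G has_field_derivative 2 * deriv q 0) (at 0)"
    by (rule has_field_derivative_transform_within_open[of _ _ _ "ball 0 1"]) (use q2 in auto)
  then have "deriv G 0 = 2 * deriv q 0" by (rule DERIV_imp_deriv)
  \<comment> \<open>Squaring and the Cayley transform each contribute a factor 2.\<close>
  then have "deriv G 0 = 4 * deriv h 0" unfolding dh by simp
  with \<open>cmod (deriv h 0) \<le> 1\<close> show ?thesis by (simp add: norm_mult)
qed

text \<open>The omitted point rules out the whole plane, so a Riemann map \<open>f\<close> with
  inverse \<open>g\<close> exists. Since \<open>1 - g / \<zeta>\<close> is univalent and zero-free
  with value 1 at 0, its derivative bound gives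
  \<open>cmod (deriv g 0) \<le> 4 * cmod \<zeta>\<close>, and \<open>deriv f 0\<close> is the
  reciprocal of \<open>deriv g 0\<close>.\<close>

lemma Koebe_quarter:
  assumes \<Omega>: "open \<Omega>" "simply_connected \<Omega>" "0 \<in> \<Omega>" "\<zeta> \<notin> \<Omega>"
  obtains f where "f holomorphic_on \<Omega>" "f ` \<Omega> \<subseteq> ball 0 1" "f 0 = 0"
    "1 / (4 * cmod \<zeta>) \<le> cmod (deriv f 0)"
proof -
  have "\<exists>f g. f holomorphic_on \<Omega> \<and> g holomorphic_on ball 0 1 \<and>
       (\<forall>z\<in>\<Omega>. f z \<in> ball 0 1 \<and> g (f z) = z) \<and> (\<forall>z\<in>ball 0 1. g z \<in> \<Omega> \<and> f (g z) = z)"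
    using \<Omega> unfolding simply_connected_eq_biholomorphic_to_disc[OF \<Omega>(1)] by blast
  then obtain f0 g0 where f0: "f0 holomorphic_on \<Omega>" "\<And>z. z \<in> \<Omega> \<Longrightarrow> f0 z \<in> ball 0 1"
      "\<And>z. z \<in> \<Omega> \<Longrightarrow> g0 (f0 z) = z"
    and g0: "g0 holomorphic_on ball 0 1" "\<And>z. z \<in> ball 0 1 \<Longrightarrow> g0 z \<in> \<Omega>"
      "\<And>z. z \<in> ball 0 1 \<Longrightarrow> f0 (g0 z) = z" by metis
  \<comment> \<open>A disc automorphism normalises the Riemann map to send 0 to 0.\<close>
  obtain m n where m: "m (f0 0) = 0" "m holomorphic_on ball 0 1" "m ` ball 0 1 \<subseteq> ball 0 1"
    "n holomorphic_on ball 0 1" "n ` ball 0 1 \<subseteq> ball 0 1"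
    "\<And>z. z \<in> ball 0 1 \<Longrightarrow> m (n z) = z" "\<And>z. z \<in> ball 0 1 \<Longrightarrow> n (m z) = z"
    by (rule ball_biholomorphism_exists[OF f0(2)[OF \<Omega>(3)]]) blast
  define f g where "f = m \<circ> f0" and "g = g0 \<circ> n"
  have f: "f holomorphic_on \<Omega>" "\<And>z. z \<in> \<Omega> \<Longrightarrow> f z \<in> ball 0 1" "f 0 = 0"
    unfolding f_def using m(1) image_subset_iff[THEN iffD1, OF m(3)] f0(2)
    by (auto intro!: holomorphic_on_compose_gen[OF f0(1) m(2)] simp del: mem_ball)
  have g: "g holomorphic_on ball 0 1" "\<And>z. z \<in> ball 0 1 \<Longrightarrow> g z \<in> \<Omega>" "\<And>z. z \<in> ball 0 1 \<Longrightarrow> f (g z) = z"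
    unfolding f_def g_def using m(6) image_subset_iff[THEN iffD1, OF m(5)] g0(2,3)
    by (auto intro!: holomorphic_on_compose_gen[OF m(4) g0(1)] simp del: mem_ball)
  have gf: "g (f z) = z" if "z \<in> \<Omega>" for z
    unfolding f_def g_def using m(7)[OF f0(2)[OF that]] f0(3)[OF that] by simp
  have g00: "g 0 = 0" using gf[OF \<Omega>(3)] f(3) by simp
  have \<zeta>0: "\<zeta> \<noteq> 0" using \<Omega> by auto
  define G where "G = (\<lambda>z. 1 - g z / \<zeta>)"
  have injg: "inj_on g (ball 0 1)" using g(3) by (metis inj_onI)
  have "cmod (deriv G 0) \<le> 4"
  proof (rule univalent_nonvanishing_deriv_le)
    show "G holomorphic_on ball 0 1" unfolding G_def using g(1) \<zeta>0 by (intro holomorphic_intros)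
    show "inj_on G (ball 0 1)" using injg \<zeta>0 by (auto simp: inj_on_def G_def)
    show "G 0 = 1" by (simp add: G_def g00)
    show "G z \<noteq> 0" if "z \<in> ball 0 1" for z using g(2)[OF that] \<Omega>(4) \<zeta>0 by (auto simp: G_def)
  qed
  have dg: "(g has_field_derivative deriv g 0) (at 0)"
    by (rule holomorphic_derivI[OF g(1)]) auto
  have "(G has_field_derivative - (deriv g 0 / \<zeta>)) (at 0)"
    unfolding G_def using \<zeta>0 by (auto intro!: derivative_eq_intros dg)
  then have "deriv G 0 = - (deriv g 0 / \<zeta>)" by (rule DERIV_imp_deriv)
  with \<open>cmod (deriv G 0) \<le> 4\<close> have dg4: "cmod (deriv g 0) \<le> 4 * cmod \<zeta>"
    using \<zeta>0 by (simp add: norm_divide field_simps)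
  have "(f has_field_derivative deriv f 0) (at (g 0))"
    using holomorphic_derivI[OF f(1) \<Omega>(1,3)] g00 by simp
  from DERIV_chain2[OF this dg]
  have "((\<lambda>z. f (g z)) has_field_derivative deriv f 0 * deriv g 0) (at 0)" .
  then have "((\<lambda>z. z) has_field_derivative deriv f 0 * deriv g 0) (at 0)"
    by (rule has_field_derivative_transform_within_open[of _ _ _ "ball 0 1"]) (use g(3) in auto)
  then have "deriv f 0 * deriv g 0 = 1" using DERIV_unique DERIV_ident by blast
  then have prod: "cmod (deriv f 0) * cmod (deriv g 0) = 1" by (metis norm_mult norm_one)
  have "1 \<le> cmod (deriv f 0) * (4 * cmod \<zeta>)"
    unfolding prod[symmetric] using dg4 by (intro mult_left_mono) auto
  then have "1 / (4 * cmod \<zeta>) \<le> cmod (deriv f 0)" using \<zeta>0 by (simp add: field_simps)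
  with f show ?thesis by (intro that[of f]) auto
qed

section \<open>Separation from complex hyperplanes\<close>

definition lines_simply_connected :: "(complex ^ 'n) set \<Rightarrow> bool"
  where "lines_simply_connected D \<longleftrightarrow> (\<forall>a b. simply_connected {t. a + t *s b \<in> D})"

lemma C_convex_lines_simply_connected:
  fixes D :: "(complex ^ 'n) set"
  assumes "C_convex D"
  shows "lines_simply_connected D"
  unfolding lines_simply_connected_def
proof (intro allI)
  fix a b :: "complex ^ 'n"
  let ?S = "{t. a + t *s b \<in> D}" and ?f = "\<lambda>t. a + t *s b"
  show "simply_connected ?S"
  proof (cases "b = 0")
    case True
    then have "?S = (if a \<in> D then UNIV else {})" by auto
    then show ?thesis by (auto intro: convex_imp_simply_connected)
  next
    case False
    show ?thesis
    proof (cases "D \<inter> range ?f = {}")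
      case True
      then have "?S = {}" by auto
      then show ?thesis by (simp only: convex_imp_simply_connected[OF convex_empty])
    next
      case nonempty: False
      \<comment> \<open>A coordinate in which \<open>b\<close> is nonzero recovers the parameter
        continuously from the point.\<close>
      obtain i where i: "b $ i \<noteq> 0" using \<open>b \<noteq> 0\<close> by (auto simp: vec_eq_iff)
      have inv: "((a + t *s b) $ i - a $ i) / b $ i = t" for t using i by simp
      have "?S homeomorphic (D \<inter> range ?f)"
      proof (rule homeomorphicI[of ?f _ _ "\<lambda>x. (x $ i - a $ i) / b $ i"])
        show "?f ` ?S = D \<inter> range ?f" by auto
        show "(\<lambda>x. (x $ i - a $ i) / b $ i) ` (D \<inter> range ?f) = ?S"
        proof (intro equalityI subsetI)
          fix t assume "t \<in> ?S"
          then show "t \<in> (\<lambda>x. (x $ i - a $ i) / b $ i) ` (D \<inter> range ?f)"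
            by (intro image_eqI[where x="?f t"]) (use inv in auto)
        qed (use inv in auto)
        show "continuous_on ?S ?f"
          by (intro continuous_intros linear_continuous_on[OF bounded_linear_smult_vec])
        show "continuous_on (D \<inter> range ?f) (\<lambda>x. (x $ i - a $ i) / b $ i)"
          using i by (intro continuous_intros) auto
      qed (use inv in auto)
      moreover have "simply_connected (D \<inter> range ?f)"
        using assms nonempty \<open>b \<noteq> 0\<close> unfolding C_convex_def complex_line_def by blast
      ultimately show ?thesis using homeomorphic_simply_connected_eq by blast
    qed
  qed
qed

text \<open>This is the preimage of the image of \<open>D\<close> in the quotient by
  \<open>span B\<close>: a point lies outside it iff its translate of \<open>span B\<close> misses
  \<open>D\<close>.\<close>

definition plus_span :: "(complex ^ 'n) set \<Rightarrow> (complex ^ 'n) set \<Rightarrow> (complex ^ 'n) set"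
  where "plus_span D B = {x + w |x w. x \<in> D \<and> w \<in> vec.span B}"

lemma subset_plus_span: "D \<subseteq> plus_span D B"
  unfolding plus_span_def using vec.span_zero by force

lemma plus_span_add:
  assumes "y \<in> plus_span D B" "w \<in> vec.span B"
  shows "y + w \<in> plus_span D B"
proof -
  obtain x w' where "y = x + w'" "x \<in> D" "w' \<in> vec.span B"
    using assms(1) by (auto simp: plus_span_def)
  then show ?thesis
    using vec.span_add[OF _ assms(2)] by (auto simp: plus_span_def add.assoc)
qed

lemma plus_span_insert: "plus_span D (insert v B) = {y. \<exists>s. y + s *s v \<in> plus_span D B}"
proof (intro equalityI subsetI)
  fix y assume "y \<in> plus_span D (insert v B)"
  then obtain x w k where "y = x + w" "x \<in> D" "w - k *s v \<in> vec.span B"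
    by (auto simp: plus_span_def vec.span_insert)
  then have "y + (- k) *s v \<in> plus_span D B"
    unfolding plus_span_def by (intro CollectI exI[of _ x] exI[of _ "w - k *s v"]) simp
  then show "y \<in> {y. \<exists>s. y + s *s v \<in> plus_span D B}" by blast
next
  fix y assume "y \<in> {y. \<exists>s. y + s *s v \<in> plus_span D B}"
  then obtain s x w where "y + s *s v = x + w" "x \<in> D" "w \<in> vec.span B"
    by (auto simp: plus_span_def)
  then have y: "y = x + (w - s *s v)" "w - s *s v - (- s) *s v \<in> vec.span B"
    by (simp_all add: algebra_simps)
  with \<open>x \<in> D\<close> show "y \<in> plus_span D (insert v B)"
    unfolding plus_span_def vec.span_insert by blast
qed

text \<open>When \<open>v\<close> is added, a slice in direction \<open>b\<close> is the projection
  of the slice of the old set in the two directions \<open>v\<close> and \<open>b\<close>;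
  \<open>simply_connected_projection\<close> applies at each step.\<close>

lemma plus_span_open_lines:
  assumes D: "open D" "lines_simply_connected D" and "finite B"
  shows "open (plus_span D B) \<and> lines_simply_connected (plus_span D B)"
  using \<open>finite B\<close>
proof induction
  case empty
  then show ?case using D by (simp add: plus_span_def)
next
  case (insert v B)
  let ?D = "plus_span D B"
  have cont: "continuous_on A (\<lambda>x. f x *s c)" if "continuous_on A f"
    for A :: "('b::topological_space) set" and f and c :: "complex ^ 'a"
    using bounded_linear.continuous_on[OF bounded_linear_smult_vec that] .
  have "open ((\<lambda>y. y + s *s v) -` ?D)" for s
    using insert.IH by (intro open_vimage continuous_intros) auto
  moreover have "plus_span D (insert v B) = (\<Union>s. (\<lambda>y. y + s *s v) -` ?D)"
    unfolding plus_span_insert by auto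
  ultimately have "open (plus_span D (insert v B))" by auto
  moreover have "simply_connected {t. a + t *s b \<in> plus_span D (insert v B)}" for a b
  proof -
    let ?E = "{q. a + snd q *s b + fst q *s v \<in> ?D}"
    have "open ((\<lambda>q. a + snd q *s b + fst q *s v) -` ?D)"
      using insert.IH by (intro open_vimage continuous_intros cont) auto
    then have "open ?E" by (simp add: vimage_def)
    moreover have "simply_connected {\<mu>. (s0 + \<mu> * s1, t0 + \<mu> * t1) \<in> ?E}" for s0 t0 s1 t1
    proof -
      have *: "a + (t0 + \<mu> * t1) *s b + (s0 + \<mu> * s1) *s v =
          (a + t0 *s b + s0 *s v) + \<mu> *s (t1 *s b + s1 *s v)" for \<mu>
        by (simp add: vec_eq_iff algebra_simps)
      from insert.IH show ?thesis
        by (simp only: mem_Collect_eq fst_conv snd_conv * lines_simply_connected_def)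
    qed
    ultimately have "simply_connected (snd ` ?E)" by (rule simply_connected_projection)
    also have "snd ` ?E = {t. a + t *s b \<in> plus_span D (insert v B)}"
      unfolding plus_span_insert by (auto intro!: image_eqI[where x="(_, _)"])
    finally show ?thesis .
  qed
  ultimately show ?case by (simp add: lines_simply_connected_def)
qed

text \<open>For a maximal independent \<open>B\<close> with \<open>p + span B\<close> disjoint from
  \<open>D\<close>, the vectors of \<open>B\<close> together with \<open>X\<close> span the space.
  The functional \<open>l\<close> is the coordinate along \<open>X\<close> modulo
  \<open>span B\<close>, and \<open>\<Omega>\<close> is the slice of \<open>D + span B\<close> along
  \<open>X\<close>.\<close>

lemma exists_separating_functional:
  fixes D :: "(complex ^ 'n) set"
  assumes D: "open D" "lines_simply_connected D" and z: "z \<in> D" and \<zeta>: "z + \<zeta> *s X \<notin> D"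
  obtains l \<Omega> where "Vector_Spaces.linear (*s) (*) l" "l X = 1"
    "open \<Omega>" "simply_connected \<Omega>" "\<zeta> \<notin> \<Omega>" "\<And>w. w \<in> D \<Longrightarrow> l (w - z) \<in> \<Omega>"
proof -
  define p where "p = z + \<zeta> *s X"
  let ?P = "\<lambda>B. vec.independent B \<and> p \<notin> plus_span D B"
  have "\<exists>B. ?P B \<and> (\<forall>B'. ?P B' \<longrightarrow> card B' \<le> card B)"
  proof (rule Lattices_Big.ex_has_greatest_nat)
    show "?P {}" using \<zeta> by (simp add: plus_span_def p_def vec.independent_empty)
    show "\<forall>B. ?P B \<longrightarrow> card B < Suc (vec.dim (UNIV :: (complex ^ 'n) set))"
      using vec.independent_card_le_dim[OF subset_UNIV] by (auto simp: less_Suc_eq_le simp del: vec.dim_UNIV)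
  qed
  then obtain B where B: "vec.independent B" "p \<notin> plus_span D B"
    and maximal: "\<And>B'. vec.independent B' \<Longrightarrow> p \<notin> plus_span D B' \<Longrightarrow> card B' \<le> card B" by blast
  have finB: "finite B" using B(1) by (rule vec.finiteI_independent)
  let ?D = "plus_span D B"
  have opD: "open ?D" and scD: "lines_simply_connected ?D"
    using plus_span_open_lines[OF D finB] by auto
  have zD: "z \<in> ?D" using z subset_plus_span by blast
  \<comment> \<open>Otherwise \<open>p = z + \<zeta> *s X\<close> would lie in
    \<open>z + span B\<close>, inside \<open>?D\<close>.\<close>
  have X: "X \<notin> vec.span B"
    using plus_span_add[OF zD, of "\<zeta> *s X"] B(2) by (auto simp: p_def vec.span_scale)
  have indep: "vec.independent (insert X B)" by (rule vec.independent_insertI[OF X B(1)])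
  \<comment> \<open>By maximality of \<open>B\<close>, a line through \<open>p\<close> in a new
    direction cannot miss \<open>?D\<close>.\<close>
  have hits: "\<exists>\<mu>. p + \<mu> *s v \<in> ?D" if v: "v \<notin> vec.span B" for v
  proof -
    have "v \<notin> B" using v vec.span_base by blast
    then have "\<not> card (insert v B) \<le> card B" using finB by simp
    then have "p \<in> plus_span D (insert v B)"
      using maximal vec.independent_insertI[OF v B(1)] by blast
    then show ?thesis by (auto simp: plus_span_insert)
  qed
  \<comment> \<open>A direction \<open>v\<close> independent of \<open>X\<close> modulo
    \<open>span B\<close> would give a plane through \<open>p\<close> in which some line through
    \<open>p\<close> misses \<open>?D\<close>, contrary to \<open>hits\<close>.\<close>
  have spanning: "v \<in> vec.span (insert X B)" for v
  proof (rule ccontr)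
    assume v: "v \<notin> vec.span (insert X B)"
    have cont: "continuous_on A (\<lambda>x. f x *s c)" if "continuous_on A f"
      for A :: "('b::topological_space) set" and f and c :: "complex ^ 'n"
      using bounded_linear.continuous_on[OF bounded_linear_smult_vec that] .
    let ?E = "{q. p + fst q *s X + snd q *s v \<in> ?D}"
    have "open ((\<lambda>q. p + fst q *s X + snd q *s v) -` ?D)"
      using opD by (intro open_vimage continuous_intros cont) auto
    then have "open ?E" by (simp add: vimage_def)
    moreover have "(0, 0) \<notin> ?E" using B(2) by simp
    moreover have line: "p + (\<mu> * x) *s X + (\<mu> * y) *s v = p + \<mu> *s (x *s X + y *s v)" for \<mu> x y
      by (simp add: vec_eq_iff algebra_simps)
    moreover have "simply_connected {\<mu>. (\<mu> * x, \<mu> * y) \<in> ?E}" for x y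
      using scD by (simp only: mem_Collect_eq fst_conv snd_conv line lines_simply_connected_def)
    ultimately obtain x y where xy: "(x, y) \<noteq> (0, 0)" "\<And>\<mu>. (\<mu> * x, \<mu> * y) \<notin> ?E"
      using line_through_origin_avoiding[of ?E] by blast
    have "x *s X + y *s v \<notin> vec.span B"
    proof
      assume *: "x *s X + y *s v \<in> vec.span B"
      show False
      proof (cases "y = 0")
        case True
        from * have "(1 / x) *s (x *s X + y *s v) \<in> vec.span B" by (rule vec.span_scale)
        also have "(1 / x) *s (x *s X + y *s v) = X"
          using True xy(1) by (simp add: vec_eq_iff)
        finally show False using X by simp
      next
        case False
        from * have "(1 / y) *s (x *s X + y *s v) \<in> vec.span B" by (rule vec.span_scale)
        also have "(1 / y) *s (x *s X + y *s v) = v - (- (x / y)) *s X"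
          using False by (simp add: vec_eq_iff field_simps)
        finally have "\<exists>k. v - k *s X \<in> vec.span B" by blast
        with v show False unfolding vec.span_insert by blast
      qed
    qed
    from hits[OF this] xy(2) show False by (auto simp: line)
  qed
  interpret vp: vector_space_pair "(*s) :: complex \<Rightarrow> complex ^ 'n \<Rightarrow> complex ^ 'n"
    "(*) :: complex \<Rightarrow> complex \<Rightarrow> complex"
    by unfold_locales
  obtain l where l: "Vector_Spaces.linear (*s) (*) l"
    "\<And>x. x \<in> insert X B \<Longrightarrow> l x = (if x = X then 1 else 0)"
    using vp.linear_independent_extend[OF indep, of "\<lambda>x. if x = X then 1 else 0"] by blast
  interpret l: Vector_Spaces.linear "(*s)" "(*)" l by (rule l(1))
  have lX: "l X = 1" using l(2) by simp
  have lB: "l w = 0" if "w \<in> vec.span B" for w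
  proof (rule vp.linear_eq_0_on_span[OF l(1) _ that])
    fix x assume "x \<in> B"
    then show "l x = 0" using l(2)[of x] X vec.span_base by auto
  qed
  let ?\<Omega> = "{t. z + t *s X \<in> ?D}"
  show ?thesis
  proof (rule that[OF l(1) lX, of ?\<Omega>])
    have "open ((\<lambda>t. z + t *s X) -` ?D)"
      using opD by (intro open_vimage continuous_intros linear_continuous_on[OF bounded_linear_smult_vec])
    then show "open ?\<Omega>" by (simp add: vimage_def)
    show "simply_connected ?\<Omega>" using scD by (simp add: lines_simply_connected_def)
    show "\<zeta> \<notin> ?\<Omega>" using B(2) by (simp add: p_def)
    show "l (w - z) \<in> ?\<Omega>" if w: "w \<in> D" for w
    proof -
      obtain k where k: "(w - z) - k *s X \<in> vec.span B"
        using spanning[of "w - z"] by (auto simp: vec.span_insert)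
      then have "l (w - z) = k" using lB[OF k] lX by (simp add: l.diff l.scale)
      moreover have "w + - ((w - z) - k *s X) \<in> ?D"
        using w subset_plus_span vec.span_neg[OF k] by (intro plus_span_add) blast+
      ultimately show ?thesis by (simp add: add.commute)
    qed
  qed
qed

section \<open>Comparison of the invariant metrics\<close>

lemma kobayashi_metric_le:
  assumes "d > 0" and disc: "\<And>t. cmod t < d \<Longrightarrow> z + t *s X \<in> D"
  shows "kobayashi_metric D z X \<le> 1 / d"
proof -
  define \<phi> where "\<phi> = (\<lambda>\<zeta>. z + (complex_of_real d * \<zeta>) *s X)"
  have "holomorphic_disc_in D \<phi>"
    using disc \<open>d > 0\<close>
    by (auto simp: holomorphic_disc_in_def \<phi>_def norm_mult intro!: holomorphic_intros)
  moreover have "deriv (\<lambda>\<zeta>. \<phi> \<zeta> $ i) 0 = complex_of_real d * X $ i" for i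
    by (rule DERIV_imp_deriv) (auto simp: \<phi>_def intro!: derivative_eq_intros)
  then have "complex_of_real (1 / d) *s (\<chi> i. deriv (\<lambda>\<zeta>. \<phi> \<zeta> $ i) 0) = X"
    using \<open>d > 0\<close> by (simp add: vec_eq_iff)
  moreover have "\<phi> 0 = z" by (simp add: \<phi>_def)
  ultimately have "1 / d \<in> {\<alpha>. 0 \<le> \<alpha> \<and> (\<exists>\<phi>. holomorphic_disc_in D \<phi> \<and> \<phi> 0 = z \<and>
      complex_of_real \<alpha> *s (\<chi> i. deriv (\<lambda>\<zeta>. \<phi> \<zeta> $ i) 0) = X)}"
    using \<open>d > 0\<close> by (intro CollectI conjI exI[of _ \<phi>]) auto
  then show ?thesis
    unfolding kobayashi_metric_def by (intro cInf_lower) (auto intro: bdd_belowI[of _ 0])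
qed

lemma caratheodory_metric_ge:
  assumes "open D" "z \<in> D" "holomorphic_to_disc D f" "f z = 0"
  shows "cmod (frechet_derivative f (at z) X) \<le> caratheodory_metric D z X"
  unfolding caratheodory_metric_def
  using assms by (intro cSup_upper caratheodory_set_bdd_above) auto

lemma caratheodory_metric_nonneg:
  assumes "open D" "z \<in> D"
  shows "0 \<le> caratheodory_metric D z X"
proof -
  obtain f where "holomorphic_to_disc D f" "f z = 0"
    using caratheodory_set_nonempty[of z X D] by blast
  from caratheodory_metric_ge[OF assms this, of X] show ?thesis
    by (meson norm_ge_zero order_trans)
qed

text \<open>The competitor is the Koebe map composed with \<open>l (w - z)\<close>; as
  \<open>l X = 1\<close>, its derivative in direction \<open>X\<close> at \<open>z\<close> is
  \<open>deriv f 0\<close>.\<close>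

lemma caratheodory_metric_ge_boundary:
  fixes D :: "(complex ^ 'n) set"
  assumes D: "open D" "C_convex D" and z: "z \<in> D" and \<zeta>: "z + \<zeta> *s X \<notin> D"
  shows "1 / (4 * cmod \<zeta>) \<le> caratheodory_metric D z X"
proof -
  obtain l \<Omega> where l: "Vector_Spaces.linear (*s) (*) l" "l X = 1"
    and \<Omega>: "open \<Omega>" "simply_connected \<Omega>" "\<zeta> \<notin> \<Omega>" and lD: "\<And>w. w \<in> D \<Longrightarrow> l (w - z) \<in> \<Omega>"
    using exists_separating_functional[OF D(1) C_convex_lines_simply_connected[OF D(2)] z \<zeta>] by blast
  interpret l: Vector_Spaces.linear "(*s)" "(*)" l by (rule l(1))
  have l0: "l 0 = 0" by (rule l.zero)
  have "0 \<in> \<Omega>" using lD[OF z] l0 by simp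
  from Koebe_quarter[OF \<Omega>(1,2) this \<Omega>(3)] obtain f where f: "f holomorphic_on \<Omega>"
    "f ` \<Omega> \<subseteq> ball 0 1" "f 0 = 0" "1 / (4 * cmod \<zeta>) \<le> cmod (deriv f 0)" by blast
  have "linear l"
  proof (rule linearI)
    show "l (r *\<^sub>R x) = r *\<^sub>R l x" for r x
    proof -
      have "r *\<^sub>R x = of_real r *s x" by (simp add: vec_eq_iff scaleR_conv_of_real[where 'a=complex])
      then show ?thesis by (simp add: l.scale scaleR_conv_of_real)
    qed
  qed (rule l.add)
  then have bl: "bounded_linear l" by (simp add: linear_conv_bounded_linear)
  define F where "F = (\<lambda>w. f (l (w - z)))"
  have der: "(F has_derivative (\<lambda>h. deriv f (l (w - z)) * l h)) (at w)" if "w \<in> D" for w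
  proof -
    have "((\<lambda>w. l (w - z)) has_derivative l) (at w)"
      by (rule bounded_linear.has_derivative[OF bl]) (auto intro!: derivative_eq_intros)
    moreover have "(f has_derivative (*) (deriv f (l (w - z)))) (at (l (w - z)))"
      using holomorphic_derivI[OF f(1) \<Omega>(1) lD[OF that]] by (simp add: has_field_derivative_def)
    ultimately show ?thesis unfolding F_def by (rule has_derivative_compose)
  qed
  have lin: "Vector_Spaces.linear (*s) (*) (\<lambda>h. c * l h)" for c
    by unfold_locales (simp_all add: l.add l.scale algebra_simps)
  have "holomorphic_to_disc D F"
    unfolding holomorphic_to_disc_def using der lin lD f(2) by (auto simp: F_def image_subset_iff)
  moreover have "F z = 0" by (simp add: F_def l0 f(3))
  moreover have "frechet_derivative F (at z) X = deriv f 0"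
    using frechet_derivative_at[OF der[OF z], symmetric] by (simp add: l0 l(2))
  ultimately show ?thesis
    using caratheodory_metric_ge[OF D(1) z, of F X] f(4) by simp
qed

theorem corollary2:
  fixes D :: "(complex ^ 'n) set"
    and z X :: "complex ^ 'n"
  assumes "open D" and "connected D"
    and "C_convex D"
    and "z \<in> D"
  shows "kobayashi_metric D z X \<le> 4 * caratheodory_metric D z X"
proof (cases "\<exists>t. z + t *s X \<notin> D")
  case False
  \<comment> \<open>The whole complex line lies in \<open>D\<close>, so affine discs of arbitrarily
    large radius \<open>1 / e\<close> are available. The case \<open>X = 0\<close> is
    included.\<close>
  have "kobayashi_metric D z X \<le> 0 + e" if "e > 0" for e
    using kobayashi_metric_le[of "1 / e" z X D] False that by auto
  then have "kobayashi_metric D z X \<le> 0" by (rule field_le_epsilon)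
  with caratheodory_metric_nonneg[OF assms(1,4), of X] show ?thesis by linarith
next
  case True
  let ?K = "- {t. z + t *s X \<in> D}"
  have "open ((\<lambda>t. z + t *s X) -` D)"
    using assms(1) by (intro open_vimage continuous_intros linear_continuous_on[OF bounded_linear_smult_vec])
  then have "closed ?K" by (simp add: vimage_def closed_Compl)
  moreover have "?K \<noteq> {}" using True by blast
  \<comment> \<open>A nearest omitted parameter serves both bounds: the affine disc of radius
    \<open>cmod \<zeta>\<close> stays in \<open>D\<close>, and \<open>z + \<zeta> *s X\<close> is
    the omitted point.\<close>
  ultimately obtain \<zeta> where \<zeta>: "\<zeta> \<in> ?K" "\<And>t. t \<in> ?K \<Longrightarrow> dist 0 \<zeta> \<le> dist 0 t"
    using distance_attains_inf[of ?K 0] by blast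
  then have \<zeta>D: "z + \<zeta> *s X \<notin> D" by simp
  have "\<zeta> \<noteq> 0" using \<zeta>D assms(4) by auto
  then have "kobayashi_metric D z X \<le> 1 / cmod \<zeta>"
    using \<zeta>(2) by (intro kobayashi_metric_le) force+
  also have "\<dots> \<le> 4 * caratheodory_metric D z X"
    using caratheodory_metric_ge_boundary[OF assms(1,3,4) \<zeta>D] by simp
  finally show ?thesis .
qed

end
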